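(* Let $Q$ be a real, symmetric, positive definite $n\times n$ matrix and let $B$ be a real $n\times n$ matrix all of whose eigenvalues have negative real parts. There exist constants $\alpha_0<\infty$ and $0<c\le C<\infty$, depending only on $n$, $Q$ and $B$, such that for any $t>1$ and any $\alpha>\alpha_0$ there exists a function $f\in L^1(\gamma_\infty)$ with $\|f\|_{L^1(\gamma_\infty)}=1$ such that $$\frac{c}{\alpha\sqrt{\log\alpha}}\le\gamma_\infty\{x\in\mathbb R^n:|\mathcal H_tf(x)|>\alpha\}\le\frac{C}{\alpha\sqrt{\log\alpha}}.$$
   Context: For $0<t\le+\infty$ let $Q_t=\int_0^t e^{sB}Qe^{sB^*}\,ds$, a symmetric positive definite matrix, and let $\gamma_t$ be the Gaussian probability measure on $\mathbb R^n$ with density $y\mapsto(2\pi)^{-n/2}(\det Q_t)^{-1/2}\exp\left(-\frac12\langle Q_t^{-1}y,y\rangle\right)$ with respect to Lebesgue measure. The Ornstein--Uhlenbeck semigroup $(\mathcal H_t)_{t>0}$ with covariance $Q$ and drift $B$ is given by Kolmogorov's formula $\mathcal H_tf(x)=\int f(e^{tB}x-y)\,d\gamma_t(y)$, $x\in\mathbb R^n$, for bounded continuous $f$. Equivalently, $\mathcal H_tf(x)=\int K_t(x,u)f(u)\,d\gamma_\infty(u)$, an absolutely convergent integral for every $f\in L^1(\gamma_\infty)$, $t>0$, $x\in\mathbb R^n$, which defines $\mathcal H_tf$ for $f\in L^1(\gamma_\infty)$. Here the Mehler kernel is $$K_t(x,u)=\Big(\frac{\det Q_\infty}{\det Q_t}\Big)^{1/2}\exp(R(x))\exp\Big[-\tfrac12\big\langle(Q_t^{-1}-Q_\infty^{-1})(u-D_tx),\,u-D_tx\big\rangle\Big],$$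 with $R(x)=\frac12\langle Q_\infty^{-1}x,x\rangle$ and $D_t=Q_\infty e^{-tB^*}Q_\infty^{-1}$. *)

theory Defs
  imports "HOL-Analysis.Analysis"
begin

(* The type real^'n^'n carries no ring structure compatible with the matrix product **
   (its * is componentwise), so exp is not available for matrices. *)
definition mat_exp :: "real^'n^'n \<Rightarrow> real^'n^'n" where
  "mat_exp A = (\<Sum>k. (1 / fact k) *\<^sub>R (((**) A ^^ k) (mat 1)))"

definition pos_def_mat :: "real^'n^'n \<Rightarrow> bool" where
  "pos_def_mat A \<longleftrightarrow> transpose A = A \<and> (\<forall>x. x \<noteq> 0 \<longrightarrow> (A *v x) \<bullet> x > 0)"

(* Eigenvalues of a real matrix are taken in the complex numbers. *)
definition cpx_eigenvalue :: "real^'n^'n \<Rightarrow> complex \<Rightarrow> bool" where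
  "cpx_eigenvalue A z \<longleftrightarrow>
     (\<exists>v :: complex^'n. v \<noteq> 0 \<and> map_matrix complex_of_real A *v v = z *s v)"

(* Q_t for 0 < t \<le> \<infinity>. *)
definition cov_mat :: "real^'n^'n \<Rightarrow> real^'n^'n \<Rightarrow> ereal \<Rightarrow> real^'n^'n" where
  "cov_mat Q B t =
     integral {s. 0 \<le> s \<and> ereal s \<le> t}
       (\<lambda>s. mat_exp (s *\<^sub>R B) ** Q ** mat_exp (s *\<^sub>R transpose B))"

lemma cov_mat_ereal:
  "cov_mat Q B (ereal t) =
     integral {0..t} (\<lambda>s. mat_exp (s *\<^sub>R B) ** Q ** mat_exp (s *\<^sub>R transpose B))"
  by (simp add: cov_mat_def atLeastAtMost_def atLeast_def atMost_def Collect_conj_eq)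

lemma cov_mat_infinity:
  "cov_mat Q B \<infinity> =
     integral {0..} (\<lambda>s. mat_exp (s *\<^sub>R B) ** Q ** mat_exp (s *\<^sub>R transpose B))"
  by (simp add: cov_mat_def atLeast_def)

definition gauss_measure :: "real^'n^'n \<Rightarrow> real^'n^'n \<Rightarrow> ereal \<Rightarrow> (real^'n) measure" where
  "gauss_measure Q B t =
     density lborel (\<lambda>y. ennreal
       ((2 * pi) powr (- real CARD('n) / 2) * det (cov_mat Q B t) powr (- 1 / 2)
         * exp (- (1 / 2) * ((matrix_inv (cov_mat Q B t) *v y) \<bullet> y))))"

definition R_form :: "real^'n^'n \<Rightarrow> real^'n^'n \<Rightarrow> real^'n \<Rightarrow> real" where
  "R_form Q B x = 1 / 2 * ((matrix_inv (cov_mat Q B \<infinity>) *v x) \<bullet> x)"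

definition D_mat :: "real^'n^'n \<Rightarrow> real^'n^'n \<Rightarrow> real \<Rightarrow> real^'n^'n" where
  "D_mat Q B t =
     cov_mat Q B \<infinity> ** mat_exp ((- t) *\<^sub>R transpose B) ** matrix_inv (cov_mat Q B \<infinity>)"

definition mehler_kernel ::
    "real^'n^'n \<Rightarrow> real^'n^'n \<Rightarrow> real \<Rightarrow> real^'n \<Rightarrow> real^'n \<Rightarrow> real" where
  "mehler_kernel Q B t x u =
     (det (cov_mat Q B \<infinity>) / det (cov_mat Q B t)) powr (1 / 2) * exp (R_form Q B x)
       * exp (- (1 / 2) *
           (((matrix_inv (cov_mat Q B t) - matrix_inv (cov_mat Q B \<infinity>))
               *v (u - D_mat Q B t *v x))
             \<bullet> (u - D_mat Q B t *v x)))"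

(* Kolmogorov's formula covers bounded continuous f only; the kernel form is the one that
   defines the semigroup on all of L^1 of the invariant measure. *)
definition OU_semigroup ::
    "real^'n^'n \<Rightarrow> real^'n^'n \<Rightarrow> real \<Rightarrow> (real^'n \<Rightarrow> real) \<Rightarrow> real^'n \<Rightarrow> real" where
  "OU_semigroup Q B t f x =
     integral\<^sup>L (gauss_measure Q B \<infinity>) (\<lambda>u. mehler_kernel Q B t x u * f u)"

end

theory Submission
  imports Defs "HOL-Computational_Algebra.Fundamental_Theorem_Algebra" "HOL-Probability.Probability"
begin

text \<open>
  Exponentials are mapped to exponentials: if f(u) = exp(\<langle>a, u\<rangle> - \<langle>Q_\<infinity> a, a\<rangle>/2), which has norm 1
  in L^1(\<gamma>_\<infinity>), then H_t f(x) = exp(\<langle>b, x\<rangle> - \<langle>Q_\<infinity> b, b\<rangle>/2) with b = exp(tB^*) a, and b may be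
  prescribed because exp(tB^*) is invertible. Choosing \<langle>Q_\<infinity> b, b\<rangle> = 2 ln \<alpha>, the level set
  {H_t f > \<alpha>} is the half space {\<langle>b, x\<rangle> > 2 ln \<alpha>}, whose \<gamma>_\<infinity>-measure is the standard normal tail
  at sqrt(2 ln \<alpha>). Mills' ratio makes it comparable to 1/(\<alpha> sqrt(ln \<alpha>)).
\<close>

section \<open>Matrix exponentials\<close>

text \<open>The value of <Q_\<infinity> b, b> is the sharp one: writing it as s^2, the condition H_t
  f > \<alpha> says that a standard normal variable exceeds (ln \<alpha>)/s + s/2. This threshold is
  least at s = sqrt(2 ln \<alpha>), where it equals s, and there exp(-s^2/2) = 1/\<alpha>.
  Prescribing b instead of a makes the level set the same for every t, hence the constants uniform
  in t.

  Most of the work makes Q_\<infinity> usable. Its convergence needs exponential decay of exp(sB)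
  from a purely spectral hypothesis; this is obtained vector by vector from annihilating
  polynomials, without Jordan form. The splitting Q_\<infinity> = Q_t + exp(tB) Q_\<infinity>
  exp(tB)^T then carries the algebra: it yields positivity of Q_\<infinity>, turns the Mehler kernel
  times the density of \<gamma>_\<infinity> into the Gaussian density with mean exp(tB) x and
  covariance Q_t, and gives the constant in the image of an exponential. Gaussian integrals become
  products of one-dimensional ones through a factorization S = A A^T, which replaces
  diagonalization.\<close>

abbreviation mat_pow :: "real^'n^'n \<Rightarrow> nat \<Rightarrow> real^'n^'n" where
  "mat_pow A k \<equiv> ((**) A ^^ k) (mat 1)"

lemma matrix_mult_entry: "(A ** B) $ i $ j = (\<Sum>l\<in>UNIV. A $ i $ l * B $ l $ j)"
  by (simp add: matrix_matrix_mult_def)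

lemma mat_pow_commute: "mat_pow A k ** A = A ** mat_pow A k"
  by (induction k) (simp_all add: matrix_mul_assoc[symmetric])

lemma mat_pow_scaleR: "mat_pow (t *\<^sub>R A) k = t ^ k *\<^sub>R mat_pow A k"
  by (induction k) (simp_all add: matrix_scalar_ac scalar_matrix_assoc mult.commute)

lemma mat_pow_transpose: "mat_pow (transpose A) k = transpose (mat_pow A k)"
proof (induction k)
  case (Suc k)
  have "mat_pow (transpose A) (Suc k) = transpose (mat_pow A k ** A)"
    by (simp add: Suc matrix_transpose_mul)
  then show ?case by (simp add: mat_pow_commute)
qed (simp add: transpose_mat)

text \<open>The sum of all absolute entries dominates every row sum, so each multiplication costs
  one such factor. The entries of the exponential series are thereby majorized by a scalar
  exponential series.\<close>

lemma mat_pow_entry_bound: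
  fixes A :: "real^'n^'n"
  shows "\<bar>mat_pow A k $ i $ j\<bar> \<le> (\<Sum>i\<in>UNIV. \<Sum>j\<in>UNIV. \<bar>A $ i $ j\<bar>) ^ k"
proof (induction k arbitrary: i j)
  case (Suc k)
  let ?M = "\<Sum>i\<in>UNIV. \<Sum>j\<in>UNIV. \<bar>A $ i $ j\<bar>"
  have "\<bar>mat_pow A (Suc k) $ i $ j\<bar> \<le> (\<Sum>l\<in>UNIV. \<bar>A $ i $ l\<bar> * \<bar>mat_pow A k $ l $ j\<bar>)"
    by (simp add: matrix_matrix_mult_def abs_mult[symmetric] sum_abs)
  also have "\<dots> \<le> (\<Sum>l\<in>UNIV. \<bar>A $ i $ l\<bar> * ?M ^ k)"
    by (intro sum_mono mult_left_mono Suc.IH) auto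
  also have "\<dots> = (\<Sum>l\<in>UNIV. \<bar>A $ i $ l\<bar>) * ?M ^ k"
    by (simp add: sum_distrib_right)
  also have "\<dots> \<le> ?M * ?M ^ k"
    by (intro mult_right_mono zero_le_power sum_nonneg member_le_sum) (auto intro: sum_nonneg)
  finally show ?case by simp
qed (simp add: mat_def)

lemma summable_mat_exp_entry:
  fixes A :: "real^'n^'n"
  shows "summable (\<lambda>k. mat_pow A k $ i $ j / fact k * t ^ k)"
proof (rule summable_comparison_test)
  let ?M = "\<Sum>i\<in>UNIV. \<Sum>j\<in>UNIV. \<bar>A $ i $ j\<bar>"
  show "summable (\<lambda>k. (?M * \<bar>t\<bar>) ^ k /\<^sub>R fact k)"
    by (rule summable_exp_generic)
  show "\<exists>N. \<forall>k\<ge>N. norm (mat_pow A k $ i $ j / fact k * t ^ k) \<le> (?M * \<bar>t\<bar>) ^ k /\<^sub>R fact k"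
    by (auto simp: abs_mult power_abs power_mult_distrib field_simps
          intro!: mult_left_mono mat_pow_entry_bound exI[of _ 0])
qed

text \<open>Keeping \<open>t ^ k\<close> apart from the coefficient makes every entry a scalar power
  series in \<open>t\<close>, to which termwise differentiation applies.\<close>

lemma mat_exp_entry:
  fixes A :: "real^'n^'n"
  shows "mat_exp (t *\<^sub>R A) $ i $ j = (\<Sum>k. mat_pow A k $ i $ j / fact k * t ^ k)"
proof -
  let ?S = "\<chi> i j. \<Sum>k. mat_pow A k $ i $ j / fact k * t ^ k"
  have "(\<lambda>k. (1 / fact k) *\<^sub>R mat_pow (t *\<^sub>R A) k) sums ?S"
    unfolding sums_def
  proof (intro vec_tendstoI)
    fix i j
    have "(\<lambda>n. \<Sum>k<n. mat_pow A k $ i $ j / fact k * t ^ k) \<longlonglongrightarrow> ?S $ i $ j"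
      using summable_mat_exp_entry[of A i j t] by (simp add: summable_LIMSEQ)
    then show "(\<lambda>n. (\<Sum>k<n. (1 / fact k) *\<^sub>R mat_pow (t *\<^sub>R A) k) $ i $ j) \<longlonglongrightarrow> ?S $ i $ j"
      by (simp add: mat_pow_scaleR mult.commute)
  qed
  then show ?thesis
    unfolding mat_exp_def by (simp add: sums_unique[symmetric])
qed

lemma mat_exp_zero [simp]: "mat_exp (0 :: real^'n^'n) = mat 1"
proof -
  have "mat_exp (0 *\<^sub>R (0 :: real^'n^'n)) $ i $ j = mat 1 $ i $ j" for i j
    unfolding mat_exp_entry powser_zero by simp
  then show ?thesis by (simp add: vec_eq_iff)
qed

lemma mat_exp_transpose: "mat_exp (t *\<^sub>R transpose A) = transpose (mat_exp (t *\<^sub>R A))"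
  by (simp add: vec_eq_iff mat_exp_entry mat_pow_transpose) (simp add: transpose_def mat_exp_entry)

lemma mat_exp_commute: "mat_exp (t *\<^sub>R A) ** A = A ** mat_exp (t *\<^sub>R A)"
proof -
  have "(mat_exp (t *\<^sub>R A) ** A) $ i $ j = (A ** mat_exp (t *\<^sub>R A)) $ i $ j" for i j
  proof -
    have "(mat_exp (t *\<^sub>R A) ** A) $ i $ j
        = (\<Sum>l\<in>UNIV. \<Sum>k. mat_pow A k $ i $ l / fact k * t ^ k * A $ l $ j)"
      by (simp only: matrix_matrix_mult_def vec_lambda_beta mat_exp_entry suminf_mult2[OF summable_mat_exp_entry])
    also have "\<dots> = (\<Sum>k. (\<Sum>l\<in>UNIV. mat_pow A k $ i $ l / fact k * t ^ k * A $ l $ j))"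
      by (intro suminf_sum[symmetric] summable_mult2 summable_mat_exp_entry)
    also have "\<dots> = (\<Sum>k. (mat_pow A k ** A) $ i $ j / fact k * t ^ k)"
      by (simp add: matrix_matrix_mult_def sum_distrib_left sum_distrib_right sum_divide_distrib mult_ac)
    also have "\<dots> = (\<Sum>k. (\<Sum>l\<in>UNIV. A $ i $ l * (mat_pow A k $ l $ j / fact k * t ^ k)))"
      unfolding mat_pow_commute
      by (simp add: matrix_matrix_mult_def sum_distrib_left sum_distrib_right sum_divide_distrib mult_ac)
    also have "\<dots> = (\<Sum>l\<in>UNIV. \<Sum>k. A $ i $ l * (mat_pow A k $ l $ j / fact k * t ^ k))"
      by (intro suminf_sum summable_mult summable_mat_exp_entry)
    also have "\<dots> = (A ** mat_exp (t *\<^sub>R A)) $ i $ j"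
      by (simp only: matrix_matrix_mult_def vec_lambda_beta mat_exp_entry suminf_mult[OF summable_mat_exp_entry])
    finally show ?thesis .
  qed
  then show ?thesis by (simp add: vec_eq_iff)
qed

lemma DERIV_mat_exp_entry:
  fixes A :: "real^'n^'n"
  shows "((\<lambda>t. mat_exp (t *\<^sub>R A) $ i $ j) has_field_derivative (mat_exp (t *\<^sub>R A) ** A) $ i $ j) (at t)"
proof -
  let ?c = "\<lambda>k. mat_pow A k $ i $ j / fact k"
  have der: "((\<lambda>t. mat_exp (t *\<^sub>R A) $ i $ j) has_field_derivative (\<Sum>k. diffs ?c k * t ^ k)) (at t)"
    unfolding mat_exp_entry by (intro termdiffs_strong_converges_everywhere summable_mat_exp_entry)
  have "diffs ?c k = (\<Sum>l\<in>UNIV. mat_pow A k $ i $ l / fact k * A $ l $ j)" for k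
  proof -
    \<comment> \<open>The factor k + 1 of the formal derivative cancels against the factorial;
      writing the next power with \<open>A\<close> on the right produces the claimed
      product.\<close>
    have "diffs ?c k = mat_pow A (Suc k) $ i $ j / fact k"
      by (simp add: diffs_def del: funpow.simps of_nat_Suc)
    also have "mat_pow A (Suc k) = mat_pow A k ** A"
      by (simp add: mat_pow_commute)
    finally show ?thesis
      by (simp add: matrix_mult_entry sum_divide_distrib)
  qed
  then have "(\<Sum>k. diffs ?c k * t ^ k)
      = (\<Sum>k. \<Sum>l\<in>UNIV. mat_pow A k $ i $ l / fact k * t ^ k * A $ l $ j)"
    by (simp add: sum_distrib_right sum_distrib_left mult_ac)
  also have "\<dots> = (\<Sum>l\<in>UNIV. \<Sum>k. mat_pow A k $ i $ l / fact k * t ^ k * A $ l $ j)"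
    by (intro suminf_sum summable_mult2 summable_mat_exp_entry)
  also have "\<dots> = (mat_exp (t *\<^sub>R A) ** A) $ i $ j"
    by (simp only: matrix_matrix_mult_def vec_lambda_beta mat_exp_entry suminf_mult2[OF summable_mat_exp_entry])
  finally show ?thesis using der by simp
qed

lemma continuous_on_mat_exp:
  fixes A :: "real^'n^'n"
  shows "continuous_on S (\<lambda>t. mat_exp (t *\<^sub>R A))"
proof -
  have "continuous_on S (\<lambda>t. \<chi> i j. mat_exp (t *\<^sub>R A) $ i $ j)"
    by (intro continuous_on_vec_lambda continuous_at_imp_continuous_on ballI
        DERIV_isCont[OF DERIV_mat_exp_entry])
  then show ?thesis by simp
qed

text \<open>The product exp((s+t-u)A) exp(uA) has derivative zero in u; its values at u = 0 and u =
  t are the two sides.\<close>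

lemma mat_exp_add:
  fixes A :: "real^'n^'n"
  shows "mat_exp ((s + t) *\<^sub>R A) = mat_exp (s *\<^sub>R A) ** mat_exp (t *\<^sub>R A)"
proof -
  let ?E = "\<lambda>t. mat_exp (t *\<^sub>R A)"
  \<comment> \<open>Reassembles the entrywise product rule, in the factor order of
    \<open>DERIV_mult\<close>, into a difference of matrix products.\<close>
  have entry: "(\<Sum>l\<in>UNIV. - X $ i $ l * Y $ l $ j + Z $ l $ j * W $ i $ l) = (W ** Z) $ i $ j - (X ** Y) $ i $ j"
    for X Y Z W :: "real^'n^'n" and i j
    by (simp add: matrix_matrix_mult_def sum.distrib sum_negf sum_subtractf mult.commute)
  have "(?E (s + t - u) ** ?E u) $ i $ j = (?E (s + t - v) ** ?E v) $ i $ j" for i j u v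
  proof (rule DERIV_isconst_all[where f = "\<lambda>u. (?E (s + t - u) ** ?E u) $ i $ j"])
    show "\<forall>u. ((\<lambda>u. (?E (s + t - u) ** ?E u) $ i $ j) has_field_derivative 0) (at u)"
    proof
      fix u
      have "((\<lambda>u. s + t - u) has_field_derivative -1) (at u)"
        by (auto intro!: derivative_eq_intros)
      from DERIV_chain2[OF DERIV_mat_exp_entry this]
      have "((\<lambda>u. ?E (s + t - u) $ i $ l) has_field_derivative - (?E (s + t - u) ** A) $ i $ l) (at u)" for l
        by simp
      then have "((\<lambda>u. (?E (s + t - u) ** ?E u) $ i $ j) has_field_derivative
         (\<Sum>l\<in>UNIV. - (?E (s + t - u) ** A) $ i $ l * ?E u $ l $ j
             + (?E u ** A) $ l $ j * ?E (s + t - u) $ i $ l)) (at u)"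
        unfolding matrix_matrix_mult_def[of "?E (s + t - _)" "?E _"] vec_lambda_beta
        by (intro DERIV_sum DERIV_mult DERIV_mat_exp_entry)
      moreover have "(\<Sum>l\<in>UNIV. - (?E (s + t - u) ** A) $ i $ l * ?E u $ l $ j
             + (?E u ** A) $ l $ j * ?E (s + t - u) $ i $ l)
           = (?E (s + t - u) ** (A ** ?E u)) $ i $ j - ((?E (s + t - u) ** A) ** ?E u) $ i $ j"
        unfolding mat_exp_commute[of u A]
        by (rule entry)
      ultimately show "((\<lambda>u. (?E (s + t - u) ** ?E u) $ i $ j) has_field_derivative 0) (at u)"
        by (simp add: matrix_mul_assoc)
    qed
  qed
  from this[of 0 _ _ t] show ?thesis
    by (simp add: vec_eq_iff)
qed

lemma mat_exp_inverse: "mat_exp (t *\<^sub>R A) ** mat_exp (- t *\<^sub>R A) = mat 1"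
    and mat_exp_inverse': "mat_exp (- t *\<^sub>R A) ** mat_exp (t *\<^sub>R A) = mat 1"
  using mat_exp_add[of t "-t" A] mat_exp_add[of "-t" t A] by simp_all

section \<open>Exponential decay of the flow of a stable matrix\<close>

abbreviation cpx_mat :: "real^'n^'n \<Rightarrow> complex^'n^'n" where
  "cpx_mat A \<equiv> map_matrix complex_of_real A"

text \<open>This is p(T) v by Horner's scheme. Evaluating on a fixed vector suffices below, since
  each vector gets its own annihilating polynomial.\<close>

definition poly_act :: "complex^'n^'n \<Rightarrow> complex poly \<Rightarrow> complex^'n \<Rightarrow> complex^'n" where
  "poly_act T p v = fold_coeffs (\<lambda>a w. a *s v + T *v w) p 0"

lemma poly_act_0 [simp]: "poly_act T 0 v = 0"
  by (simp add: poly_act_def)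

lemma poly_act_pCons [simp]: "poly_act T (pCons a p) v = a *s v + T *v poly_act T p v"
  by (cases "p = 0 \<and> a = 0") (auto simp: poly_act_def)

lemma poly_act_add: "poly_act T (p + q) v = poly_act T p v + poly_act T q v"
  by (induction p q rule: poly_induct2)
    (simp_all add: vector_sadd_rdistrib  algebra_simps matrix_vector_right_distrib)

lemma poly_act_smult: "poly_act T (smult c p) v = c *s poly_act T p v"
  by (induction p) (simp_all add: vector_add_ldistrib vector_smult_assoc vec.scale)

lemma poly_act_diff: "poly_act T (p - q) v = poly_act T p v - poly_act T q v"
  using poly_act_add[of T "p - q" q v] by simp

lemma poly_act_commute: "poly_act T p (T *v v) = T *v poly_act T p v"
  by (induction p) (simp_all add: matrix_vector_right_distrib vec.scale)

lemma poly_act_diff_arg: "poly_act T p (v - w) = poly_act T p v - poly_act T p w"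
  by (induction p) (simp_all add: vector_ssub_ldistrib matrix_vector_mult_diff_distrib)

lemma poly_act_smult_arg: "poly_act T p (c *s v) = c *s poly_act T p v"
  by (induction p) (simp_all add: vector_add_ldistrib vector_smult_assoc vec.scale mult.commute)

text \<open>With the linear factor applied last, annihilation of v by the product makes q(T) v an
  eigenvector as soon as it is nonzero.\<close>

lemma poly_act_linear_factor:
  "poly_act T ([:- \<mu>, 1:] * q) v = T *v poly_act T q v - \<mu> *s poly_act T q v"
  by (simp add: poly_act_diff poly_act_smult)

text \<open>With the linear factor applied first, q annihilates (T - \<mu>) v, which is the form
  that an induction on the degree needs.\<close>

lemma poly_act_linear_factor':
  "poly_act T ([:- \<mu>, 1:] * q) v = poly_act T q (T *v v - \<mu> *s v)"
  unfolding poly_act_linear_factor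
  by (simp add: poly_act_commute poly_act_diff_arg poly_act_smult_arg)

text \<open>The vectors T^k v, with k from 0 up to the real dimension of the space, are one too many
  to be independent.\<close>

lemma ex_annihilating_poly:
  fixes v :: "complex^'n"
  shows "\<exists>p. p \<noteq> 0 \<and> poly_act T p v = 0"
proof -
  define w where "w k = poly_act T (monom 1 k) v" for k
  \<comment> \<open>Dependence is a property of sets, so a repetition among the powers would go
    unnoticed; it is treated apart, with coefficients 1 and -1 at the two equal vectors.\<close>
  have ex: "\<exists>c::nat \<Rightarrow> real. (\<exists>k\<le>n. c k \<noteq> 0) \<and> (\<Sum>k\<le>n. c k *\<^sub>R w k) = 0" if "DIM(complex^'n) \<le> n" for n
  proof (cases "inj_on w {..n}")
    case True
    then have "dependent (w ` {..n})"
      using that by (intro dependent_biggerset) (auto simp: card_image)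
    then obtain u where u: "\<exists>x\<in>w ` {..n}. u x \<noteq> 0" "(\<Sum>x\<in>w ` {..n}. u x *\<^sub>R x) = 0"
      by (auto simp: dependent_finite)
    then show ?thesis
      using True by (intro exI[of _ "u \<circ> w"]) (auto simp: sum.reindex)
  next
    case False
    then obtain i j where ij: "i \<le> n" "j \<le> n" "i \<noteq> j" "w i = w j"
      by (auto simp: inj_on_def)
    let ?c = "\<lambda>k. (if k = i then 1 else 0) - (if k = j then 1 else 0 :: real)"
    have "(\<Sum>k\<le>n. ?c k *\<^sub>R w k) = 0"
      using ij by (simp add: scaleR_left_diff_distrib sum_subtractf if_distrib[of "\<lambda>x. x *\<^sub>R _"] cong: if_cong)
    moreover have "?c i \<noteq> 0" using ij by simp
    ultimately show ?thesis
      using ij(1) by (intro exI[of _ ?c] conjI exI[of _ i]) simp_all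
  qed
  from ex[OF order_refl] obtain c :: "nat \<Rightarrow> real" and k where c: "k \<le> DIM(complex^'n)" "c k \<noteq> 0"
    "(\<Sum>k\<le>DIM(complex^'n). c k *\<^sub>R w k) = 0" by blast
  define p where "p = (\<Sum>k\<le>DIM(complex^'n). monom (complex_of_real (c k)) k)"
  have "coeff p k = (\<Sum>j\<le>DIM(complex^'n). coeff (monom (complex_of_real (c j)) j) k)"
    by (simp add: p_def coeff_sum)
  also have "\<dots> = c k"
    using c(1) by (simp add: coeff_monom)
  finally have "coeff p k = c k" .
  then have "p \<noteq> 0" using c(2) by auto
  moreover have "poly_act T p v = (\<Sum>k\<le>DIM(complex^'n). c k *\<^sub>R w k)"
  proof -
    have "poly_act T (sum g S) v = (\<Sum>k\<in>S. poly_act T (g k) v)" if "finite S" for g and S :: "nat set"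
      using that by induction (simp_all add: poly_act_add)
    moreover have "poly_act T (monom (complex_of_real a) k) v = a *\<^sub>R w k" for a k
      using poly_act_smult[of T "complex_of_real a" "monom 1 k" v]
      by (simp add: w_def smult_monom vec_eq_iff scaleR_conv_of_real[where 'a = complex])
    ultimately show ?thesis by (simp add: p_def)
  qed
  ultimately show ?thesis using c(3) by auto
qed

text \<open>Take p of least degree. Dividing by the factor of a root z leaves a q of smaller degree,
  so q(B) v is nonzero, and it is an eigenvector for z.\<close>

lemma ex_annihilating_poly_eigenvalues:
  fixes B :: "real^'n^'n"
  shows "\<exists>p. p \<noteq> 0 \<and> poly_act (cpx_mat B) p v = 0 \<and> (\<forall>z. poly p z = 0 \<longrightarrow> cpx_eigenvalue B z)"
proof -
  let ?T = "cpx_mat B"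
  define P where "P p \<longleftrightarrow> p \<noteq> 0 \<and> poly_act ?T p v = 0" for p
  obtain p where p: "P p" and least: "\<And>q. P q \<Longrightarrow> degree p \<le> degree q"
    using ex_has_least_nat[of P _ degree] ex_annihilating_poly[of ?T v] by (auto simp: P_def)
  have "cpx_eigenvalue B z" if "poly p z = 0" for z
  proof -
    from that obtain q where q: "p = [:- z, 1:] * q"
      by (auto simp: poly_eq_0_iff_dvd dvd_def)
    have "q \<noteq> 0" using p q by (auto simp: P_def)
    moreover have "degree p = Suc (degree q)"
      unfolding q using \<open>q \<noteq> 0\<close> by (subst degree_mult_eq) auto
    ultimately have "poly_act ?T q v \<noteq> 0"
      using least[of q] by (auto simp: P_def)
    moreover have "?T *v poly_act ?T q v = z *s poly_act ?T q v"
      using p unfolding P_def q poly_act_linear_factor by simp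
    ultimately show ?thesis by (auto simp: cpx_eigenvalue_def)
  qed
  then show ?thesis using p by (auto simp: P_def)
qed

lemma has_vector_derivative_cpx_mat_exp:
  fixes B :: "real^'n^'n"
  shows "((\<lambda>t. (cpx_mat (mat_exp (t *\<^sub>R B)) *v v) $ i) has_vector_derivative
           (cpx_mat (mat_exp (t *\<^sub>R B)) *v (cpx_mat B *v v)) $ i) (at t within S)"
proof -
  let ?E = "\<lambda>t. mat_exp (t *\<^sub>R B)"
  have "((\<lambda>t. \<Sum>l\<in>UNIV. complex_of_real (?E t $ i $ l) * v $ l) has_vector_derivative
      (\<Sum>l\<in>UNIV. complex_of_real ((?E t ** B) $ i $ l) * v $ l)) (at t within S)"
    by (intro has_vector_derivative_sum has_vector_derivative_mult_left has_vector_derivative_of_real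
        DERIV_mat_exp_entry[THEN has_field_derivative_at_within])
  moreover have "(\<Sum>l\<in>UNIV. complex_of_real ((?E t ** B) $ i $ l) * v $ l)
      = (cpx_mat (?E t ** B) *v v) $ i"
    by (simp add: matrix_vector_mult_def map_matrix_def)
  moreover have "cpx_mat (?E t ** B) = cpx_mat (?E t) ** cpx_mat B"
    by (simp add: vec_eq_iff map_matrix_def matrix_matrix_mult_def)
  ultimately show ?thesis
    by (simp add: matrix_vector_mul_assoc) (simp add: matrix_vector_mult_def map_matrix_def)
qed

text \<open>The derivative of exp(-\<mu>t) exp(tB) v is exp(-\<mu>t) exp(tB) (B - \<mu>) v, so decay at rate \<omega> passes
  from (B - \<mu>) v to v.\<close>

lemma decay_step:
  fixes B :: "real^'n^'n"
  assumes \<mu>: "Re \<mu> \<le> - 2 * \<omega>" and \<omega>: "0 < \<omega>"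
    and M: "\<And>i t. 0 \<le> t \<Longrightarrow>
      cmod ((cpx_mat (mat_exp (t *\<^sub>R B)) *v (cpx_mat B *v v - \<mu> *s v)) $ i) \<le> M * exp (- \<omega> * t)"
  shows "\<exists>M. \<forall>i. \<forall>t\<ge>0. cmod ((cpx_mat (mat_exp (t *\<^sub>R B)) *v v) $ i) \<le> M * exp (- \<omega> * t)"
proof (intro exI allI impI)
  fix i and t :: real assume t: "0 \<le> t"
  let ?y = "\<lambda>v t. (cpx_mat (mat_exp (t *\<^sub>R B)) *v v) $ i"
  \<comment> \<open>The growth rate of the derivative's bound after multiplication by exp(-\<mu>s).
    The factor 2 in the hypothesis on \<mu> keeps it at least \<omega>, so the primitive is again
    exponential and no powers of t accumulate, even for repeated roots.\<close>
  define \<kappa> where "\<kappa> = - Re \<mu> - \<omega>"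
  have \<kappa>: "\<omega> \<le> \<kappa>" "0 < \<kappa>" using assms by (auto simp: \<kappa>_def)
  have M0: "0 \<le> M" using order_trans[OF norm_ge_zero M[of 0]] by simp
  let ?\<phi> = "\<lambda>s. exp (- \<mu> * of_real s) * ?y v s"
  let ?\<psi> = "\<lambda>s. M / \<kappa> * exp (\<kappa> * s)"
  \<comment> \<open>Mean value inequality for vector-valued functions: the derivative of
    \<open>?\<psi>\<close> dominates the norm of the derivative of \<open>?\<phi>\<close>.\<close>
  have "norm (?\<phi> t - ?\<phi> 0) \<le> ?\<psi> t - ?\<psi> 0"
  proof (cases "t = 0")
    case False
    have der: "(?\<phi> has_vector_derivative exp (- \<mu> * of_real s) * ?y (cpx_mat B *v v - \<mu> *s v) s) (at s)" for s
    proof -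
      have "((\<lambda>s. exp (- \<mu> * of_real s)) has_vector_derivative - \<mu> * exp (- \<mu> * of_real s)) (at s)"
        by (rule has_vector_derivative_real_field) (auto intro!: derivative_eq_intros)
      from has_vector_derivative_mult[OF this has_vector_derivative_cpx_mat_exp[of B v i s UNIV]]
      show ?thesis
        by (simp add: matrix_vector_mult_diff_distrib vec.scale algebra_simps)
    qed
    have der': "(?\<psi> has_vector_derivative M * exp (\<kappa> * s)) (at s)" for s
      using \<kappa> by (auto intro!: derivative_eq_intros simp: has_real_derivative_iff_has_vector_derivative[symmetric])
    show ?thesis
    proof (rule differentiable_bound_general)
      show "0 < t" using t False by simp
      show "continuous_on {0..t} ?\<phi>" "continuous_on {0..t} ?\<psi>"
        using der der' by (auto intro!: continuous_at_imp_continuous_on has_vector_derivative_continuous)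
      fix s assume s: "0 < s" "s < t"
      show "(?\<phi> has_vector_derivative exp (- \<mu> * of_real s) * ?y (cpx_mat B *v v - \<mu> *s v) s) (at s)"
        by (rule der)
      show "(?\<psi> has_vector_derivative M * exp (\<kappa> * s)) (at s)"
        by (rule der')
      have "norm (exp (- \<mu> * of_real s) * ?y (cpx_mat B *v v - \<mu> *s v) s)
          \<le> exp (- Re \<mu> * s) * (M * exp (- \<omega> * s))"
        using M[of s i] s by (simp add: norm_mult)
      also have "\<dots> = M * exp (\<kappa> * s)"
        by (simp add: \<kappa>_def exp_add[symmetric] algebra_simps)
      finally show "norm (exp (- \<mu> * of_real s) * ?y (cpx_mat B *v v - \<mu> *s v) s) \<le> M * exp (\<kappa> * s)" .
    qed
  qed simp
  also have "\<dots> \<le> ?\<psi> t" using M0 \<kappa> by simp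
  finally have "cmod (?\<phi> t) \<le> cmod (?y v 0) + ?\<psi> t"
    using norm_triangle_sub[of "?\<phi> t" "?\<phi> 0"] by simp
  moreover have "cmod (?y v 0) \<le> (\<Sum>i\<in>UNIV. cmod (v $ i))"
  proof -
    have "cpx_mat (mat 1) = (mat 1 :: complex^'n^'n)"
      by (simp add: vec_eq_iff map_matrix_def mat_def)
    then show ?thesis
      using member_le_sum[of i UNIV "\<lambda>i. cmod (v $ i)"] by simp
  qed
  ultimately have bound: "cmod (?\<phi> t) \<le> (\<Sum>i\<in>UNIV. cmod (v $ i)) + ?\<psi> t" by linarith
  \<comment> \<open>Undoing the factor exp(-\<mu>t) turns exp(\<kappa>t) into exp(-\<omega>t), while
    the initial value decays even faster.\<close>
  have "cmod (?y v t) = exp (Re \<mu> * t) * cmod (?\<phi> t)"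
    by (simp add: norm_mult exp_add[symmetric] mult.assoc[symmetric])
  also have "\<dots> \<le> exp (Re \<mu> * t) * ((\<Sum>i\<in>UNIV. cmod (v $ i)) + ?\<psi> t)"
    by (intro mult_left_mono bound) simp
  also have "\<dots> = exp (Re \<mu> * t) * (\<Sum>i\<in>UNIV. cmod (v $ i)) + M / \<kappa> * exp (- \<omega> * t)"
    by (simp add: \<kappa>_def distrib_left exp_add[symmetric] algebra_simps)
  also have "exp (Re \<mu> * t) * (\<Sum>i\<in>UNIV. cmod (v $ i)) \<le> exp (- \<omega> * t) * (\<Sum>i\<in>UNIV. cmod (v $ i))"
    using mult_right_mono[of "Re \<mu>" "- \<omega>" t] \<mu> \<omega> t by (intro mult_right_mono sum_nonneg) auto
  finally show "cmod (?y v t) \<le> ((\<Sum>i\<in>UNIV. cmod (v $ i)) + M / \<kappa>) * exp (- \<omega> * t)"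
    by (simp add: algebra_simps)
qed

text \<open>Roots are peeled off one at a time: q annihilates (B - z) v, whose decay passes to v by
  \<open>decay_step\<close> at the same rate \<omega>. A constant nonzero p forces v = 0.\<close>

lemma decay_of_annihilating_poly:
  fixes B :: "real^'n^'n"
  assumes "p \<noteq> 0" "poly_act (cpx_mat B) p v = 0" "0 < \<omega>"
    and "\<And>z. poly p z = 0 \<Longrightarrow> Re z \<le> - 2 * \<omega>"
  shows "\<exists>M. \<forall>i. \<forall>t\<ge>0. cmod ((cpx_mat (mat_exp (t *\<^sub>R B)) *v v) $ i) \<le> M * exp (- \<omega> * t)"
  using assms
proof (induction "degree p" arbitrary: p v)
  case 0
  then obtain c where "p = [:c:]" by (auto elim: degree_eq_zeroE)
  with 0 have "v = 0" by simp
  then show ?case by (auto intro!: exI[of _ 0])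
next
  case (Suc n)
  have "\<exists>z. poly p z = 0"
    using Suc.hyps by (intro fundamental_theorem_of_algebra_alt) (auto elim: degree_eq_zeroE)
  then obtain z q where z: "poly p z = 0" and q: "p = [:- z, 1:] * q"
    by (auto simp: poly_eq_0_iff_dvd dvd_def)
  have "q \<noteq> 0" using Suc.prems q by auto
  moreover have "degree p = Suc (degree q)"
    unfolding q using \<open>q \<noteq> 0\<close> by (subst degree_mult_eq) auto
  moreover have "poly_act (cpx_mat B) q (cpx_mat B *v v - z *s v) = 0"
    using Suc.prems(2) unfolding q poly_act_linear_factor' .
  moreover have "Re y \<le> - 2 * \<omega>" if "poly q y = 0" for y
    using Suc.prems(4)[of y] that unfolding q by simp
  ultimately have "\<exists>M. \<forall>i. \<forall>t\<ge>0.
     cmod ((cpx_mat (mat_exp (t *\<^sub>R B)) *v (cpx_mat B *v v - z *s v)) $ i) \<le> M * exp (- \<omega> * t)"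
    using Suc.hyps Suc.prems(3) by simp
  then show ?case
    using decay_step[OF Suc.prems(4)[OF z] Suc.prems(3)] by blast
qed

lemma mat_exp_decay:
  fixes B :: "real^'n^'n"
  assumes "\<And>z. cpx_eigenvalue B z \<Longrightarrow> Re z < 0"
  shows "\<exists>M \<omega>. 0 < \<omega> \<and> (\<forall>t\<ge>0. norm (mat_exp (t *\<^sub>R B)) \<le> M * exp (- \<omega> * t))"
proof -
  have "\<exists>q. 0 < snd q \<and>
      (\<forall>i. \<forall>t\<ge>0. cmod ((cpx_mat (mat_exp (t *\<^sub>R B)) *v v) $ i) \<le> fst q * exp (- snd q * t))" for v
  proof -
    obtain p where p: "p \<noteq> 0" "poly_act (cpx_mat B) p v = 0" "\<And>z. poly p z = 0 \<Longrightarrow> Re z < 0"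
      using ex_annihilating_poly_eigenvalues[of B v] assms by blast
    \<comment> \<open>Inserting -1 keeps the set nonempty when p has no roots, so that its maximum
      exists and is negative.\<close>
    let ?R = "insert (-1) (Re ` {z. poly p z = 0})"
    have fin: "finite ?R" using p(1) by (simp add: poly_roots_finite)
    \<comment> \<open>Half the distance to the imaginary axis; the other half is the slack that each
      peeled root consumes.\<close>
    define \<omega> where "\<omega> = - Max ?R / 2"
    have "Max ?R < 0" using fin p(3) by (subst Max_less_iff) auto
    then have "0 < \<omega>" by (simp add: \<omega>_def)
    moreover have "Re z \<le> - 2 * \<omega>" if "poly p z = 0" for z
      using Max_ge[OF fin, of "Re z"] that by (simp add: \<omega>_def)
    ultimately obtain M where
      "\<forall>i. \<forall>t\<ge>0. cmod ((cpx_mat (mat_exp (t *\<^sub>R B)) *v v) $ i) \<le> M * exp (- \<omega> * t)"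
      using decay_of_annihilating_poly[OF p(1,2)] by blast
    with \<open>0 < \<omega>\<close> show ?thesis by (intro exI[of _ "(M, \<omega>)"]) simp
  qed
  then obtain F where F: "\<And>v. 0 < snd (F v) \<and>
      (\<forall>i. \<forall>t\<ge>0. cmod ((cpx_mat (mat_exp (t *\<^sub>R B)) *v v) $ i) \<le> fst (F v) * exp (- snd (F v) * t))"
    using choice[of "\<lambda>v q. 0 < snd q \<and>
      (\<forall>i. \<forall>t\<ge>0. cmod ((cpx_mat (mat_exp (t *\<^sub>R B)) *v v) $ i) \<le> fst q * exp (- snd q * t))"]
    by blast
  define M \<omega> where "M v = fst (F v)" and "\<omega> v = snd (F v)" for v
  have \<omega>: "\<And>v. 0 < \<omega> v"
    and M: "\<And>v i t. 0 \<le> t \<Longrightarrow> cmod ((cpx_mat (mat_exp (t *\<^sub>R B)) *v v) $ i) \<le> M v * exp (- \<omega> v * t)"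
    using F by (simp_all add: M_def \<omega>_def)
  \<comment> \<open>Applied to the standard basis the vector estimate controls the columns; the
    smallest of the finitely many rates serves for all.\<close>
  let ?a = "\<lambda>j::'n. axis j 1 :: complex^'n"
  define \<omega>0 where "\<omega>0 = Min (range (\<lambda>j. \<omega> (?a j)))"
  have \<omega>0: "0 < \<omega>0" "\<And>j. \<omega>0 \<le> \<omega> (?a j)"
    using \<omega> by (auto simp: \<omega>0_def)
  have M0: "0 \<le> M v" for v using order_trans[OF norm_ge_zero M[of 0 v]] by simp
  have "\<bar>mat_exp (t *\<^sub>R B) $ i $ j\<bar> \<le> M (?a j) * exp (- \<omega>0 * t)" if "0 \<le> t" for i j t
  proof -
    have "\<bar>mat_exp (t *\<^sub>R B) $ i $ j\<bar> = cmod ((cpx_mat (mat_exp (t *\<^sub>R B)) *v ?a j) $ i)"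
      by (simp add: matrix_vector_mult_def map_matrix_def axis_def if_distrib cong: if_cong)
    also have "\<dots> \<le> M (?a j) * exp (- \<omega> (?a j) * t)" by (rule M[OF that])
    also have "\<dots> \<le> M (?a j) * exp (- \<omega>0 * t)"
      using that \<omega>0(2)[of j] M0 by (intro mult_left_mono) (auto intro!: mult_right_mono)
    finally show ?thesis .
  qed note entry = this
  have "norm (mat_exp (t *\<^sub>R B)) \<le> (\<Sum>i\<in>(UNIV::'n set). \<Sum>j\<in>UNIV. M (?a j)) * exp (- \<omega>0 * t)" if "0 \<le> t" for t
  proof -
    have "norm (mat_exp (t *\<^sub>R B)) \<le> (\<Sum>i\<in>UNIV. norm (mat_exp (t *\<^sub>R B) $ i))"
      by (simp add: norm_vec_def L2_set_le_sum)
    also have "\<dots> \<le> (\<Sum>i\<in>UNIV. \<Sum>j\<in>UNIV. norm (mat_exp (t *\<^sub>R B) $ i $ j))"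
      by (intro sum_mono norm_le_l1_cart[THEN order_trans]) simp
    also have "\<dots> \<le> (\<Sum>i\<in>(UNIV::'n set). \<Sum>j\<in>UNIV. M (?a j) * exp (- \<omega>0 * t))"
      using entry[OF that] by (intro sum_mono) simp
    finally show ?thesis by (simp only: sum_distrib_right)
  qed
  then show ?thesis using \<omega>0(1) by blast
qed

section \<open>The covariance matrices\<close>

lemma bounded_bilinear_matrix_mult:
  "bounded_bilinear ((**) :: real^'n^'n \<Rightarrow> real^'n^'n \<Rightarrow> real^'n^'n)"
  unfolding bilinear_conv_bounded_bilinear[symmetric] bilinear_def
  by (auto intro!: linearI simp: matrix_mult_entry vec_eq_iff distrib_left distrib_right sum.distrib sum_distrib_left mult_ac)

lemma inner_matrix_transpose:
  fixes A :: "real^'n^'n"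
  shows "(A *v x) \<bullet> y = x \<bullet> (transpose A *v y)"
  by (metis dot_lmul_matrix transpose_transpose vector_transpose_matrix)

lemma bounded_linear_quadratic_form:
  fixes x :: "real^'n"
  shows "bounded_linear (\<lambda>A. (A *v x) \<bullet> x)"
  unfolding linear_conv_bounded_linear[symmetric]
  by (rule linearI)
    (simp_all add: matrix_vector_mult_add_rdistrib inner_add_left scaleR_matrix_vector_assoc[symmetric])

lemma bounded_linear_transpose: "bounded_linear (transpose :: real^'n^'n \<Rightarrow> real^'n^'n)"
  unfolding linear_conv_bounded_linear[symmetric]
  by (rule linearI) (simp_all add: transpose_def vec_eq_iff)

section \<open>Convergence, splitting and positivity of the covariance integrals\<close>

locale stable_pair =
  fixes Q B :: "real^'n^'n"
  assumes pos_Q: "pos_def_mat Q"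
    and stable: "\<And>z. cpx_eigenvalue B z \<Longrightarrow> Re z < 0"
begin

definition "E s = mat_exp (s *\<^sub>R B)"

definition "G s = E s ** Q ** transpose (E s)"

lemma E_add: "E (s + t) = E s ** E t"
  by (simp add: E_def mat_exp_add)

lemma E_uminus: "E t ** E (- t) = mat 1" "E (- t) ** E t = mat 1"
  using mat_exp_inverse[of t B] mat_exp_inverse'[of t B] by (simp_all add: E_def)

lemma continuous_on_G: "continuous_on S G"
  unfolding G_def E_def
  by (intro bounded_bilinear.continuous_on[OF bounded_bilinear_matrix_mult] continuous_on_const
      bounded_linear.continuous_on[OF bounded_linear_transpose] continuous_on_mat_exp)

lemma borel_measurable_G [measurable]: "G \<in> borel_measurable borel"
  by (intro borel_measurable_continuous_onI continuous_on_G)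

text \<open>The integrand contains the flow twice, so it decays at rate 2\<omega>. Here the spectral
  hypothesis on \<open>B\<close> enters.\<close>

lemma set_integrable_G: "set_integrable lborel {0..} G"
proof -
  obtain M \<omega> where \<omega>: "0 < \<omega>" and M: "\<And>t. 0 \<le> t \<Longrightarrow> norm (E t) \<le> M * exp (- \<omega> * t)"
    using mat_exp_decay[OF stable] unfolding E_def by blast
  have bb: "bounded_bilinear (\<lambda>(X :: real^'n^'n) (Y :: real^'n^'n). X ** Q ** transpose Y)"
    using bounded_bilinear.comp[OF bounded_bilinear_matrix_mult
        bounded_bilinear.bounded_linear_left[OF bounded_bilinear_matrix_mult, of Q] bounded_linear_transpose] .
  obtain K where K: "0 < K" "\<And>(X :: real^'n^'n) (Y :: real^'n^'n). norm (X ** Q ** transpose Y) \<le> norm X * norm Y * K"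
    using bounded_bilinear.pos_bounded[OF bb] by blast
  have M0: "0 \<le> M" using order_trans[OF norm_ge_zero M[of 0]] by simp
  have "norm (G s) \<le> M * M * K * exp (- (2 * \<omega>) * s)" if "s \<in> {0..}" for s
  proof -
    have "norm (G s) \<le> norm (E s) * norm (E s) * K" unfolding G_def by (rule K(2))
    also have "\<dots> \<le> (M * exp (- \<omega> * s)) * (M * exp (- \<omega> * s)) * K"
      using that M[of s] M0 K(1) by (intro mult_right_mono mult_mono) auto
    also have "\<dots> = M * M * K * exp (- (2 * \<omega>) * s)"
      by (simp add: mult_exp_exp algebra_simps)
    finally show ?thesis .
  qed
  moreover have "(\<lambda>s. M * M * K * exp (- (2 * \<omega>) * s)) integrable_on {0..}"
    using \<omega> by (intro integrable_on_mult_right integrable_on_exp_minus_to_infinity) simp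
  moreover have "G \<in> borel_measurable (lebesgue_on {0..})"
    by (intro continuous_imp_measurable_on_sets_lebesgue continuous_on_G) auto
  ultimately have "G absolutely_integrable_on {0..}"
    by (intro measurable_bounded_by_integrable_imp_absolutely_integrable) auto
  then show ?thesis
    unfolding set_integrable_def by (subst (asm) integrable_completion) auto
qed

abbreviation "Qinf \<equiv> cov_mat Q B \<infinity>"
abbreviation "Qt t \<equiv> cov_mat Q B (ereal t)"

lemma Qt_eq: "Qt t = integral {0..t} G"
  by (simp add: cov_mat_ereal G_def[abs_def] E_def mat_exp_transpose)

text \<open>Both readings are used: the Lebesgue integral for the substitution s to t + s, the gauge
  integral for joining intervals and passing to quadratic forms.\<close>

lemma Qinf_eq: "Qinf = (LINT s:{0..}|lborel. G s)" "Qinf = integral {0..} G"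
  using set_borel_integral_eq_integral(2)[OF set_integrable_G]
  by (simp_all add: cov_mat_infinity G_def[abs_def] E_def mat_exp_transpose)

lemma G_add: "G (t + s) = E t ** G s ** transpose (E t)"
  by (simp add: G_def E_add matrix_transpose_mul matrix_mul_assoc)

text \<open>Shifting the tail of the integral past t lets the flow factor out on both sides. In
  probabilistic terms this is the invariance of \<gamma>_\<infinity> under the semigroup.\<close>

lemma Qinf_decomp:
  assumes "0 \<le> t"
  shows "Qinf = Qt t + E t ** Qinf ** transpose (E t)"
proof -
  have bl: "bounded_linear (\<lambda>X. E t ** X ** transpose (E t))"
    by (intro bounded_linear_compose[OF bounded_bilinear.bounded_linear_left[OF bounded_bilinear_matrix_mult]]
        bounded_bilinear.bounded_linear_right[OF bounded_bilinear_matrix_mult])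
  have intt: "set_integrable lborel {t..} G"
    by (rule set_integrable_subset[OF set_integrable_G]) (use assms in auto)
  have "integral {t..} G = (LINT s:{t..}|lborel. G s)"
    by (simp add: set_borel_integral_eq_integral[OF intt])
  also have "\<dots> = (\<integral>s. indicator {t..} (t + 1 * s) *\<^sub>R G (t + 1 * s) \<partial>lborel)"
    unfolding set_lebesgue_integral_def by (subst lborel_integral_real_affine[of 1 _ t]) simp_all
  also have "\<dots> = (\<integral>s. E t ** (indicator {0..} s *\<^sub>R G s) ** transpose (E t) \<partial>lborel)"
    by (intro Bochner_Integration.integral_cong)
      (auto simp: indicator_def G_add matrix_scalar_ac scalar_matrix_assoc[symmetric])
  also have "\<dots> = E t ** Qinf ** transpose (E t)"
    using integral_bounded_linear[OF bl set_integrable_G[unfolded set_integrable_def]]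
    by (simp add: Qinf_eq(1) set_lebesgue_integral_def)
  finally have *: "integral {t..} G = E t ** Qinf ** transpose (E t)" .
  have "(G has_integral (Qt t + integral {t..} G)) ({0..t} \<union> {t..})"
  proof (rule has_integral_Un)
    show "(G has_integral Qt t) {0..t}"
      unfolding Qt_eq by (intro integrable_integral integrable_continuous_interval continuous_on_G)
    show "(G has_integral integral {t..} G) {t..}"
      by (intro integrable_integral set_borel_integral_eq_integral(1)[OF intt])
    have "{0..t} \<inter> {t..} = {t}" using assms by auto
    then show "negligible ({0..t} \<inter> {t..})" by simp
  qed
  moreover have "{0..t} \<union> {t..} = {0..}" using assms by auto
  ultimately have "(G has_integral (Qt t + integral {t..} G)) {0..}" by simp
  from integral_unique[OF this] show ?thesis
    unfolding Qinf_eq(2)[symmetric] * .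
qed

lemma transpose_G: "transpose (G s) = G s"
  using pos_Q by (simp add: G_def matrix_transpose_mul matrix_mul_assoc pos_def_mat_def)

lemma quadratic_G: "(G s *v x) \<bullet> x = (Q *v (transpose (E s) *v x)) \<bullet> (transpose (E s) *v x)"
  unfolding G_def matrix_vector_mul_assoc[symmetric] inner_matrix_transpose[of "E s"] ..

lemma quadratic_G_nonneg: "0 \<le> (G s *v x) \<bullet> x"
  using pos_Q unfolding quadratic_G pos_def_mat_def
  by (cases "transpose (E s) *v x = 0") (auto intro: less_imp_le)

lemma quadratic_G_pos: "x \<noteq> 0 \<Longrightarrow> 0 < (G s *v x) \<bullet> x"
proof -
  assume "x \<noteq> 0"
  moreover have "transpose (E (- s)) *v (transpose (E s) *v x) = x"
    by (simp only: matrix_vector_mul_assoc matrix_transpose_mul[symmetric] E_uminus transpose_mat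
        matrix_vector_mul_lid)
  ultimately have "transpose (E s) *v x \<noteq> 0" by auto
  then show ?thesis using pos_Q unfolding quadratic_G pos_def_mat_def by blast
qed

lemma pos_def_Qt:
  assumes "0 < t"
  shows "pos_def_mat (Qt t)"
  unfolding pos_def_mat_def
proof (intro conjI allI impI)
  have int: "G integrable_on {0..t}"
    by (intro integrable_continuous_interval continuous_on_G)
  show "transpose (Qt t) = Qt t"
    using integral_linear[OF int bounded_linear_transpose, symmetric] by (simp add: Qt_eq o_def transpose_G)
  fix x :: "real^'n" assume x: "x \<noteq> 0"
  let ?g = "\<lambda>s. (G s *v x) \<bullet> x"
  have cont: "continuous_on {0..t} ?g"
    by (intro bounded_linear.continuous_on[OF bounded_linear_quadratic_form] continuous_on_G)
  \<comment> \<open>On a compact interval the continuous positive integrand has a positive minimum,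
    which bounds the integral from below.\<close>
  obtain s where s: "s \<in> {0..t}" "\<And>r. r \<in> {0..t} \<Longrightarrow> ?g s \<le> ?g r"
    using continuous_attains_inf[OF _ _ cont] assms by auto
  have "0 < t * ?g s" using assms quadratic_G_pos[OF x] by simp
  also have "\<dots> = integral {0..t} (\<lambda>_. ?g s)" using assms by simp
  also have "\<dots> \<le> integral {0..t} ?g"
    using s(2) by (intro integral_le integrable_continuous_interval cont continuous_on_const) auto
  also have "\<dots> = (Qt t *v x) \<bullet> x"
    using integral_linear[OF int bounded_linear_quadratic_form[of x]] by (simp add: Qt_eq o_def)
  finally show "0 < (Qt t *v x) \<bullet> x" .
qed

text \<open>On the half line the integrand decays to zero, so no positive minimum is available.
  Instead the splitting at time 1 adds a nonnegative form to the positive one of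
  \<open>Qt 1\<close>.\<close>

lemma pos_def_Qinf: "pos_def_mat Qinf"
  unfolding pos_def_mat_def
proof (intro conjI allI impI)
  have int: "G integrable_on {0..}"
    by (rule set_borel_integral_eq_integral(1)[OF set_integrable_G])
  show "transpose Qinf = Qinf"
    using integral_linear[OF int bounded_linear_transpose, symmetric] by (simp add: Qinf_eq(2) o_def transpose_G)
  have nonneg: "0 \<le> (Qinf *v x) \<bullet> x" for x
  proof -
    have "0 \<le> integral {0..} (\<lambda>s. (G s *v x) \<bullet> x)"
      using integrable_linear[OF int bounded_linear_quadratic_form[of x]]
      by (intro integral_nonneg quadratic_G_nonneg) (simp add: o_def)
    also have "\<dots> = (Qinf *v x) \<bullet> x"
      using integral_linear[OF int bounded_linear_quadratic_form[of x]] by (simp add: Qinf_eq(2) o_def)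
    finally show ?thesis .
  qed
  fix x :: "real^'n" assume x: "x \<noteq> 0"
  have "(Qinf *v x) \<bullet> x = (Qt 1 *v x) \<bullet> x + ((E 1 ** Qinf ** transpose (E 1)) *v x) \<bullet> x"
    by (subst Qinf_decomp[of 1])
      (simp_all only: matrix_vector_mult_add_rdistrib inner_add_left zero_le_one)
  moreover have "((E 1 ** Qinf ** transpose (E 1)) *v x) \<bullet> x
      = (Qinf *v (transpose (E 1) *v x)) \<bullet> (transpose (E 1) *v x)"
    unfolding matrix_vector_mul_assoc[symmetric] inner_matrix_transpose[of "E 1"] ..
  moreover have "0 < (Qt 1 *v x) \<bullet> x"
    using pos_def_Qt[of 1] x unfolding pos_def_mat_def by simp
  ultimately show "0 < (Qinf *v x) \<bullet> x"
    using nonneg[of "transpose (E 1) *v x"] by simp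
qed

end

section \<open>Gaussian densities\<close>

lemma prod_Basis_cart:
  fixes f :: "real^'n \<Rightarrow> 'a::comm_monoid_mult"
  shows "(\<Prod>b\<in>(Basis :: (real^'n) set). f b) = (\<Prod>i\<in>UNIV. f (axis i 1))"
proof -
  have B: "(Basis :: (real^'n) set) = range (\<lambda>i. axis i 1)"
    by (auto simp: Basis_vec_def)
  have "inj (\<lambda>i::'n. axis i (1::real))"
    by (auto intro!: injI simp: axis_eq_axis)
  from prod.reindex[OF this, of f] show ?thesis
    unfolding B comp_def .
qed

lemma borel_measurable_vec_lambda:
  fixes f :: "'a \<Rightarrow> 'n::finite \<Rightarrow> real"
  assumes "\<And>i. (\<lambda>x. f x i) \<in> borel_measurable M"
  shows "(\<lambda>x. \<chi> i. f x i) \<in> borel_measurable M"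
  by (subst borel_measurable_euclidean_space) (auto simp: Basis_vec_def inner_axis assms)

lemma borel_measurable_matrix_vector_mult [measurable]:
  fixes A :: "real^'n^'n"
  shows "(*v) A \<in> borel_measurable borel"
  by (intro borel_measurable_continuous_onI matrix_vector_mult_linear_continuous_on)

text \<open>Lebesgue measure is determined by the volumes of boxes. The product form over the index
  type makes Fubini available for a single coordinate.\<close>

lemma lborel_cart_eq_PiM:
  "(lborel :: (real^'n) measure) = distr (PiM UNIV (\<lambda>_. lborel)) borel (\<lambda>x. \<chi> i. x i)"
proof (rule lborel_eqI)
  interpret product_sigma_finite "\<lambda>_::'n. lborel :: real measure" ..
  have [measurable]: "(vec_lambda :: _ \<Rightarrow> real^'n) \<in> borel_measurable (PiM UNIV (\<lambda>_. lborel))"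
    using borel_measurable_vec_lambda[of "\<lambda>x. x" "PiM UNIV (\<lambda>_::'n. lborel)"] by simp
  fix l u :: "real^'n"
  assume le: "\<And>b. b \<in> Basis \<Longrightarrow> l \<bullet> b \<le> u \<bullet> b"
  have "(\<lambda>x. \<chi> i. x i) -` box l u \<inter> space (PiM UNIV (\<lambda>_::'n. lborel)) = (\<Pi>\<^sub>E i\<in>UNIV. {l $ i <..< u $ i})"
    by (auto simp: mem_box_cart space_PiM PiE_iff)
  then have "emeasure (distr (PiM UNIV (\<lambda>_. lborel)) borel (\<lambda>x. \<chi> i. x i)) (box l u)
      = (\<Prod>i\<in>UNIV. emeasure lborel {l $ i <..< u $ i})"
    by (simp add: emeasure_distr emeasure_PiM)
  also have "\<dots> = (\<Prod>i\<in>UNIV. ennreal (u $ i - l $ i))"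
  proof (intro prod.cong refl)
    fix i
    have "l $ i \<le> u $ i" using le[of "axis i 1"] by (simp add: inner_axis)
    then show "emeasure lborel {l $ i <..< u $ i} = ennreal (u $ i - l $ i)" by simp
  qed
  also have "\<dots> = ennreal (\<Prod>i\<in>UNIV. u $ i - l $ i)"
    using le[of "axis _ 1"] by (intro prod_ennreal) (simp add: inner_axis)
  also have "(\<Prod>i\<in>UNIV. u $ i - l $ i) = (\<Prod>b\<in>Basis. (u - l) \<bullet> b)"
    by (simp add: prod_Basis_cart inner_axis)
  finally show "emeasure (distr (PiM UNIV (\<lambda>_. lborel)) borel (\<lambda>x. \<chi> i. x i)) (box l u)
      = ennreal (\<Prod>b\<in>Basis. (u - l) \<bullet> b)" .
qed simp

lemma nn_integral_lborel_cart:
  fixes g :: "real^'n \<Rightarrow> ennreal"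
  assumes [measurable]: "g \<in> borel_measurable borel"
  shows "(\<integral>\<^sup>+x. g x \<partial>lborel) = (\<integral>\<^sup>+x. g (\<chi> i. x i) \<partial>PiM UNIV (\<lambda>_. lborel))"
proof -
  have [measurable]: "(vec_lambda :: _ \<Rightarrow> real^'n) \<in> borel_measurable (PiM UNIV (\<lambda>_. lborel))"
    using borel_measurable_vec_lambda[of "\<lambda>x. x" "PiM UNIV (\<lambda>_::'n. lborel)"] by simp
  have "(\<integral>\<^sup>+x. g x \<partial>distr (PiM UNIV (\<lambda>_. lborel)) borel vec_lambda) = (\<integral>\<^sup>+x. g (vec_lambda x) \<partial>PiM UNIV (\<lambda>_. lborel))"
    by (rule nn_integral_distr) simp_all
  then show ?thesis unfolding lborel_cart_eq_PiM[symmetric] .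
qed

lemma nn_integral_lborel_cart_prod:
  fixes h :: "'n::finite \<Rightarrow> real \<Rightarrow> ennreal"
  assumes [measurable]: "\<And>i. h i \<in> borel_measurable borel"
  shows "(\<integral>\<^sup>+x. (\<Prod>i\<in>UNIV. h i (x $ i)) \<partial>lborel) = (\<Prod>i\<in>UNIV. \<integral>\<^sup>+x. h i x \<partial>lborel)"
proof -
  interpret product_sigma_finite "\<lambda>_::'n. lborel :: real measure" ..
  have "(\<integral>\<^sup>+x. (\<Prod>i\<in>UNIV. h i (x $ i)) \<partial>lborel)
      = (\<integral>\<^sup>+x. (\<Prod>i\<in>UNIV. h i ((\<chi> i. x i) $ i)) \<partial>PiM UNIV (\<lambda>_. lborel))"
    by (rule nn_integral_lborel_cart) simp
  also have "\<dots> = (\<integral>\<^sup>+x. (\<Prod>i\<in>UNIV. h i (x i)) \<partial>PiM UNIV (\<lambda>_. lborel))"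
    by (simp only: vec_lambda_beta)
  also have "\<dots> = (\<Prod>i\<in>UNIV. \<integral>\<^sup>+x. h i x \<partial>lborel)"
    by (rule product_nn_integral_prod) simp_all
  finally show ?thesis .
qed

lemma nn_integral_lborel_transposition:
  fixes g :: "real^'n \<Rightarrow> ennreal"
  assumes [measurable]: "g \<in> borel_measurable borel"
  shows "(\<integral>\<^sup>+x. g x \<partial>lborel) = (\<integral>\<^sup>+x. g (\<chi> i. x $ Transposition.transpose m n i) \<partial>lborel)"
proof -
  let ?\<sigma> = "Transposition.transpose m n"
  let ?T = "\<lambda>x::real^'n. \<chi> i. x $ ?\<sigma> i"
  have [measurable]: "?T \<in> borel_measurable borel"
    by (intro borel_measurable_vec_lambda) simp
  have "lborel = distr lborel borel ?T"
  proof (rule lborel_eqI)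
    fix l u :: "real^'n"
    assume le: "\<And>b. b \<in> Basis \<Longrightarrow> l \<bullet> b \<le> u \<bullet> b"
    have le': "l $ i \<le> u $ i" for i using le[of "axis i 1"] by (simp add: inner_axis)
    \<comment> \<open>A swap is its own inverse, so the preimage of a box is the box with swapped
      corners, of the same volume.\<close>
    have "?T -` box l u = box (?T l) (?T u)"
      by (auto simp: mem_box_cart) (metis transpose_involutory)+
    moreover have "(?T l) \<bullet> b \<le> (?T u) \<bullet> b" if "b \<in> Basis" for b
      using that le' by (auto simp: Basis_vec_def inner_axis)
    ultimately have "emeasure (distr lborel borel ?T) (box l u) = ennreal (\<Prod>b\<in>Basis. (?T u - ?T l) \<bullet> b)"
      by (simp add: emeasure_distr)
    also have "(\<Prod>b\<in>Basis. (?T u - ?T l) \<bullet> b) = (\<Prod>i\<in>UNIV. u $ ?\<sigma> i - l $ ?\<sigma> i)"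
      by (simp add: prod_Basis_cart inner_axis)
    also have "\<dots> = (\<Prod>i\<in>UNIV. u $ i - l $ i)"
      using prod.permute[OF permutes_swap_id[of m UNIV n], of "\<lambda>i. u $ i - l $ i"] by (simp add: o_def)
    also have "\<dots> = (\<Prod>b\<in>Basis. (u - l) \<bullet> b)"
      by (simp add: prod_Basis_cart inner_axis)
    finally show "emeasure (distr lborel borel ?T) (box l u) = ennreal (\<Prod>b\<in>Basis. (u - l) \<bullet> b)" .
  qed simp
  then have "(\<integral>\<^sup>+x. g x \<partial>lborel) = (\<integral>\<^sup>+x. g x \<partial>distr lborel borel ?T)" by simp
  then show ?thesis by (simp add: nn_integral_distr)
qed

text \<open>Integrate over coordinate m first: with the others fixed, and n different from m, the
  shear is a translation in that variable.\<close>

lemma nn_integral_lborel_shear: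
  fixes g :: "real^'n \<Rightarrow> ennreal"
  assumes [measurable]: "g \<in> borel_measurable borel" and "m \<noteq> n"
  shows "(\<integral>\<^sup>+x. g x \<partial>lborel) = (\<integral>\<^sup>+x. g (\<chi> i. if i = m then c * x $ n + x $ m else x $ i) \<partial>lborel)"
proof -
  interpret product_sigma_finite "\<lambda>_::'n. lborel :: real measure" ..
  let ?S = "\<lambda>x::real^'n. \<chi> i. if i = m then c * x $ n + x $ m else x $ i"
  have [measurable]: "?S \<in> borel_measurable borel"
    by (intro borel_measurable_vec_lambda) simp
  have mvec: "(vec_lambda :: _ \<Rightarrow> real^'n) \<in> borel_measurable (PiM UNIV (\<lambda>_. lborel))"
    using borel_measurable_vec_lambda[of "\<lambda>x. x" "PiM UNIV (\<lambda>_::'n. lborel)"] by simp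
  have ins: "insert m (UNIV - {m}) = UNIV" by auto
  have split: "(\<integral>\<^sup>+x. h x \<partial>lborel)
      = (\<integral>\<^sup>+x. (\<integral>\<^sup>+y. h (\<chi> i. (x(m := y)) i) \<partial>lborel) \<partial>PiM (UNIV - {m}) (\<lambda>_. lborel))"
    if [measurable]: "h \<in> borel_measurable borel" for h :: "real^'n \<Rightarrow> ennreal"
  proof -
    have "(\<lambda>x. h (\<chi> i. x i)) \<in> borel_measurable (PiM UNIV (\<lambda>_::'n. lborel))"
      using measurable_compose[OF mvec that] .
    then have "(\<integral>\<^sup>+x. h (\<chi> i. x i) \<partial>PiM UNIV (\<lambda>_. lborel))
        = (\<integral>\<^sup>+x. (\<integral>\<^sup>+y. h (\<chi> i. (x(m := y)) i) \<partial>lborel) \<partial>PiM (UNIV - {m}) (\<lambda>_. lborel))"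
      by (intro product_nn_integral_insert[of "UNIV - {m}" m "\<lambda>x. h (\<chi> i. x i)", unfolded ins]) simp_all
    then show ?thesis unfolding nn_integral_lborel_cart[OF that] .
  qed
  have "(\<integral>\<^sup>+y. g (?S (\<chi> i. (x(m := y)) i)) \<partial>lborel) = (\<integral>\<^sup>+y. g (\<chi> i. (x(m := y)) i) \<partial>lborel)" for x
  proof -
    have mupd: "(\<lambda>y. \<chi> i. (x(m := y)) i) \<in> borel_measurable borel"
      by (intro borel_measurable_vec_lambda) simp
    have "?S (\<chi> i. (x(m := y)) i) = (\<chi> i. (x(m := c * x n + 1 * y)) i)" for y
      using \<open>m \<noteq> n\<close> by (simp add: vec_eq_iff)
    then have "(\<integral>\<^sup>+y. g (?S (\<chi> i. (x(m := y)) i)) \<partial>lborel)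
        = (\<integral>\<^sup>+y. g (\<chi> i. (x(m := c * x n + 1 * y)) i) \<partial>lborel)"
      by (simp only:)
    then show ?thesis
      using nn_integral_real_affine[OF measurable_compose[OF mupd assms(1)], of 1 "c * x n"]
      by (simp del: vec_lambda_eta fun_upd_apply)
  qed
  then show ?thesis
    by (simp only: split[OF assms(1)] split[OF measurable_compose[OF \<open>?S \<in> borel_measurable borel\<close> assms(1)]])
qed

text \<open>The library states linear changes of variables only for wellordered index types.\<close>

lemma nn_integral_lborel_linear:
  fixes A :: "real^'n^'n"
  shows "det A \<noteq> 0 \<Longrightarrow> g \<in> borel_measurable borel \<Longrightarrow>
    (\<integral>\<^sup>+x. g x \<partial>lborel) = ennreal \<bar>det A\<bar> * (\<integral>\<^sup>+x. g (A *v x) \<partial>lborel)"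
proof (induction A arbitrary: g rule: induct_matrix_elementary)
  case (1 A B)
  note [measurable] = "1.prems"(2)
  have "(\<integral>\<^sup>+x. g x \<partial>lborel) = ennreal \<bar>det A\<bar> * (\<integral>\<^sup>+x. g (A *v x) \<partial>lborel)"
    using "1.prems" by (intro "1.IH") (auto simp: det_mul)
  also have "(\<integral>\<^sup>+x. g (A *v x) \<partial>lborel) = ennreal \<bar>det B\<bar> * (\<integral>\<^sup>+x. g (A *v (B *v x)) \<partial>lborel)"
    using "1.prems" by (intro "1.IH") (auto simp: det_mul)
  finally show ?case
    by (simp add: det_mul abs_mult ennreal_mult mult.assoc matrix_vector_mul_assoc)
next
  \<comment> \<open>A zero row contradicts the nonvanishing determinant, so this case is
    vacuous.\<close>
  case (2 A i)
  then show ?case by (simp add: det_zero_row)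
next
  case (3 A)
  note [measurable] = "3.prems"(2)
  let ?c = "\<lambda>b::real^'n. (A *v b) \<bullet> b"
  have c: "?c (axis i 1) = A $ i $ i" for i
    by (simp add: inner_axis matrix_vector_mult_basis column_def)
  have det: "det A = (\<Prod>i\<in>UNIV. A $ i $ i)" by (rule det_diagonal) (rule "3.hyps")
  then have nz: "?c b \<noteq> 0" if "b \<in> Basis" for b
    using that "3.prems"(1) c by (auto simp: Basis_vec_def)
  \<comment> \<open>Brings a diagonal matrix into the shape of a coordinatewise scaling along the
    basis, whose effect on Lebesgue measure is \<open>lborel_affine_euclidean\<close>.\<close>
  have T: "(\<Sum>b\<in>Basis. (?c b * (x \<bullet> b)) *\<^sub>R b) = A *v x" for x
  proof -
    have "(A *v x) $ i = A $ i $ i * x $ i" for i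
    proof -
      have "(A *v x) $ i = (\<Sum>j\<in>UNIV. if j = i then A $ i $ i * x $ i else 0)"
        unfolding matrix_vector_mult_def vec_lambda_beta
        by (intro sum.cong) (auto simp: "3.hyps")
      then show ?thesis by simp
    qed
    then have "?c b * (x \<bullet> b) = (A *v x) \<bullet> b" if "b \<in> Basis" for b
      using that c by (auto simp: Basis_vec_def inner_axis)
    then have "(\<Sum>b\<in>Basis. (?c b * (x \<bullet> b)) *\<^sub>R b) = (\<Sum>b\<in>Basis. ((A *v x) \<bullet> b) *\<^sub>R b)"
      by (intro sum.cong) auto
    then show ?thesis by (simp add: euclidean_representation)
  qed
  have "(lborel :: (real^'n) measure)
      = density (distr lborel borel (\<lambda>x. 0 + (\<Sum>b\<in>Basis. (?c b * (x \<bullet> b)) *\<^sub>R b))) (\<lambda>_. ennreal (\<Prod>b\<in>Basis. \<bar>?c b\<bar>))"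
    by (rule lborel_affine_euclidean) (rule nz)
  also have "\<dots> = density (distr lborel borel ((*v) A)) (\<lambda>_. ennreal \<bar>det A\<bar>)"
    by (simp add: T prod_Basis_cart c det abs_prod)
  finally have "(\<integral>\<^sup>+x. g x \<partial>lborel) = (\<integral>\<^sup>+x. g x \<partial>density (distr lborel borel ((*v) A)) (\<lambda>_. ennreal \<bar>det A\<bar>))"
    by simp
  then show ?case
    by (simp add: nn_integral_density nn_integral_distr nn_integral_cmult)
next
  case (4 m n)
  let ?P = "\<chi> i j. mat 1 $ i $ Transposition.transpose m n j :: real^'n^'n"
  have "?P *v x = (\<chi> i. x $ Transposition.transpose m n i)" for x
  proof -
    have "(?P *v x) $ i = x $ Transposition.transpose m n i" for i
    proof -
      have "(i = Transposition.transpose m n j) = (j = Transposition.transpose m n i)" for j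
        by (metis transpose_involutory)
      then show ?thesis
        by (simp add: matrix_vector_mult_def mat_def if_distrib[of "\<lambda>x. x * _"] cong: if_cong)
    qed
    then show ?thesis by (simp add: vec_eq_iff)
  qed
  moreover have "\<bar>det ?P\<bar> = 1"
    by (simp add: det_permute_columns permutes_swap_id sign_swap_id abs_mult)
  ultimately show ?case
    using nn_integral_lborel_transposition[OF "4.prems"(2), of m n] by simp
next
  case (5 m n c)
  let ?P = "\<chi> i j. if i = m \<and> j = n then c else of_bool (i = j) :: real^'n^'n"
  \<comment> \<open>Written as a row operation on the identity, the shear visibly has determinant
    1.\<close>
  have P: "?P = (\<chi> k. if k = m then row m (mat 1) + c *s row n (mat 1) else row k (mat 1))"
    using "5.hyps" by (auto simp: vec_eq_iff row_def mat_def)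
  have "det ?P = 1"
    unfolding P using det_row_operation[OF "5.hyps", where c = c and A = "mat 1"] by simp
  moreover have "?P *v x = (\<chi> i. if i = m then c * x $ n + x $ m else x $ i)" for x
  proof -
    have "(?P *v x) $ i = (\<Sum>j\<in>UNIV. (if i = m \<and> j = n then c * x $ n else 0) + (if j = i then x $ i else 0))" for i
      unfolding matrix_vector_mult_def vec_lambda_beta
      using "5.hyps" by (intro sum.cong) auto
    then show ?thesis by (auto simp: vec_eq_iff sum.distrib)
  qed
  ultimately show ?case
    using nn_integral_lborel_shear[OF "5.prems"(2) "5.hyps", of c] by simp
qed

section \<open>Factorization and determinant of positive definite matrices\<close>

lemma pos_def_mat_sym: "pos_def_mat S \<Longrightarrow> (S *v x) \<bullet> y = (S *v y) \<bullet> x"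
  unfolding pos_def_mat_def
  by (metis dot_lmul_matrix inner_commute vector_transpose_matrix)

text \<open>Gram-Schmidt for the inner product <S x, y>, by induction on the index set.\<close>

lemma pos_def_mat_orthonormal_family:
  fixes S :: "real^'n^'n"
  assumes S: "pos_def_mat S"
  shows "\<exists>w :: 'n \<Rightarrow> real^'n. \<forall>i\<in>I. \<forall>j\<in>I. (S *v w i) \<bullet> w j = of_bool (i = j)"
proof -
  have "finite I" by simp
  then show ?thesis
  proof (induction I)
    case (insert k I)
    then obtain w where w: "\<And>i j. i \<in> I \<Longrightarrow> j \<in> I \<Longrightarrow> (S *v w i) \<bullet> w j = of_bool (i = j)"
      by blast
    \<comment> \<open>Since k is not in I, the vectors found so far are too few to span, which
      supplies the next vector before projection.\<close>
    have "dim (w ` I) \<le> card I"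
      using dim_le_card'[of "w ` I"] card_image_le[OF insert.hyps(1), of w] insert.hyps(1) by simp
    also have "\<dots> < card (UNIV :: 'n set)"
      using insert.hyps by (intro psubset_card_mono) auto
    finally have "span (w ` I) \<noteq> UNIV"
      by (metis DIM_cart DIM_real dim_UNIV dim_span mult.right_neutral nat_neq_iff)
    then obtain x where x: "x \<notin> span (w ` I)" by auto
    define y where "y = x - (\<Sum>i\<in>I. ((S *v x) \<bullet> w i) *\<^sub>R w i)"
    have "(\<Sum>i\<in>I. ((S *v x) \<bullet> w i) *\<^sub>R w i) \<in> span (w ` I)"
      by (intro span_sum span_mul span_base) simp
    with x have "y \<noteq> 0" by (auto simp: y_def)
    have y: "(S *v y) \<bullet> w j = 0" if "j \<in> I" for j
    proof -
      have "(S *v (\<Sum>i\<in>I. ((S *v x) \<bullet> w i) *\<^sub>R w i)) \<bullet> w j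
          = (\<Sum>i\<in>I. ((S *v x) \<bullet> w i) * ((S *v w i) \<bullet> w j))"
        by (simp add: vec.sum matrix_vector_mult_scaleR inner_sum_left)
      also have "\<dots> = (\<Sum>i\<in>I. if i = j then (S *v x) \<bullet> w j else 0)"
        using that by (intro sum.cong) (auto simp: w)
      also have "\<dots> = (S *v x) \<bullet> w j" using that insert.hyps(1) by simp
      finally show ?thesis
        by (simp add: y_def matrix_vector_mult_diff_distrib inner_diff_left)
    qed
    define a where "a = (S *v y) \<bullet> y"
    have "0 < a" using S \<open>y \<noteq> 0\<close> by (simp add: a_def pos_def_mat_def)
    define w' where "w' = w(k := (1 / sqrt a) *\<^sub>R y)"
    have "(S *v w' i) \<bullet> w' j = of_bool (i = j)" if "i \<in> insert k I" "j \<in> insert k I" for i j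
      using that insert.hyps(2) \<open>0 < a\<close> w y pos_def_mat_sym[OF S, of "w i" y]
      by (auto simp: w'_def matrix_vector_mult_scaleR a_def[symmetric] field_simps)
    then show ?case by blast
  qed simp
qed

lemma matrix_inv_unique:
  fixes A :: "real^'n^'n"
  assumes "A ** B = mat 1"
  shows "matrix_inv A = B"
  unfolding matrix_inv_def
proof (rule some_equality)
  show "A ** B = mat 1 \<and> B ** A = mat 1"
    using assms by (simp add: matrix_left_right_inverse)
  fix C assume "A ** C = mat 1 \<and> C ** A = mat 1"
  then have "C = C ** (A ** B)" "C ** A ** B = B" using assms by simp_all
  then show "C = B" by (simp add: matrix_mul_assoc)
qed

text \<open>If the rows of W are orthonormal for the form of S, then W S W^T = 1, and the inverse of
  W is the required factor.\<close>

lemma pos_def_mat_factor: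
  fixes S :: "real^'n^'n"
  assumes S: "pos_def_mat S"
  obtains A where "det A \<noteq> 0" "S = A ** transpose A"
proof -
  obtain w :: "'n \<Rightarrow> real^'n" where w: "\<And>i j. (S *v w i) \<bullet> w j = of_bool (i = j)"
    using pos_def_mat_orthonormal_family[OF S, of UNIV] by auto
  define W where "W = (\<chi> i. w i)"
  have "(W ** (S ** transpose W)) $ i $ j = of_bool (i = j)" for i j
  proof -
    have "(W ** (S ** transpose W)) $ i $ j = (S *v w j) \<bullet> w i"
      by (simp add: matrix_matrix_mult_def matrix_vector_mult_def inner_vec_def W_def transpose_def mult.commute)
    then show ?thesis using w by auto
  qed
  then have WS: "W ** (S ** transpose W) = mat 1"
    by (simp add: vec_eq_iff mat_def)
  then obtain A where AW: "A ** W = mat 1" "W ** A = mat 1"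
    by (metis invertible_def invertible_right_inverse)
  have "S = (A ** W) ** S ** transpose (A ** W)" by (simp add: AW transpose_mat)
  also have "\<dots> = A ** (W ** (S ** transpose W)) ** transpose A"
    by (simp add: matrix_transpose_mul matrix_mul_assoc)
  finally have "S = A ** transpose A" by (simp add: WS)
  moreover have "det A \<noteq> 0"
    using AW by (metis invertible_def invertible_det_nz)
  ultimately show ?thesis using that by blast
qed

lemma pos_def_mat_det_pos: "pos_def_mat S \<Longrightarrow> 0 < det S"
  by (erule pos_def_mat_factor) (metis det_mul det_transpose not_real_square_gt_zero)

section \<open>Gaussian densities: normalization and one-dimensional marginals\<close>

definition gauss_density :: "real^'n^'n \<Rightarrow> real^'n \<Rightarrow> real" where
  "gauss_density S y = (2 * pi) powr (- real CARD('n) / 2) * det S powr (- 1 / 2)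
     * exp (- (1 / 2) * ((matrix_inv S *v y) \<bullet> y))"

lemma gauss_density_nonneg [simp]: "0 \<le> gauss_density S y"
  by (simp add: gauss_density_def)

lemma borel_measurable_gauss_density [measurable]: "gauss_density S \<in> borel_measurable borel"
  unfolding gauss_density_def[abs_def] by measurable

lemma powr_minus_half_power: "0 < (r :: real) \<Longrightarrow> r powr (- real k / 2) = (1 / sqrt r) ^ k"
  by (simp add: powr_half_sqrt[symmetric] powr_minus_divide powr_powr power_one_over
      flip: powr_realpow)

text \<open>In the coordinates y = A z the form of the inverse of A A^T becomes |z|^2, and the
  Jacobian cancels the determinant in the normalization.\<close>

lemma gauss_density_linear:
  fixes A :: "real^'n^'n"
  assumes A: "det A \<noteq> 0" and S: "S = A ** transpose A"
  shows "\<bar>det A\<bar> * gauss_density S (A *v z) = (\<Prod>i\<in>UNIV. std_normal_density (z $ i))"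
proof -
  have "invertible A" using A by (simp add: invertible_det_nz)
  then obtain W where W: "A ** W = mat 1" "W ** A = mat 1" by (auto simp: invertible_def)
  have "transpose A ** transpose W = mat 1"
    by (simp add: matrix_transpose_mul[symmetric] W transpose_mat)
  then have "S ** (transpose W ** W) = mat 1"
    by (metis S W(1) matrix_mul_assoc matrix_mul_rid)
  then have "matrix_inv S = transpose W ** W" by (rule matrix_inv_unique)
  then have "matrix_inv S *v (A *v z) = transpose W *v z"
    by (simp add: matrix_vector_mul_assoc matrix_mul_assoc[symmetric] W)
  then have "(matrix_inv S *v (A *v z)) \<bullet> (A *v z) = z \<bullet> ((W ** A) *v z)"
    by (simp add: dot_lmul_matrix matrix_vector_mul_assoc)
  then have quad: "(matrix_inv S *v (A *v z)) \<bullet> (A *v z) = (\<Sum>i\<in>UNIV. (z $ i)\<^sup>2)"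
    by (simp add: W inner_vec_def power2_eq_square)
  have "det S = \<bar>det A\<bar> powr 2" using A by (simp add: S det_mul power2_eq_square abs_mult_self_eq)
  then have "\<bar>det A\<bar> * det S powr (- 1 / 2) = 1"
    using A by (simp add: powr_powr powr_minus)
  then have "\<bar>det A\<bar> * gauss_density S (A *v z)
      = (2 * pi) powr (- real CARD('n) / 2) * exp (- (\<Sum>i\<in>UNIV. (z $ i)\<^sup>2) / 2)"
    by (simp add: gauss_density_def quad)
  moreover have "(\<Prod>i\<in>UNIV. std_normal_density (z $ i))
      = (1 / sqrt (2 * pi)) ^ CARD('n) * exp (\<Sum>i\<in>UNIV. - (z $ i)\<^sup>2 / 2)"
    by (simp add: std_normal_density_def prod.distrib exp_sum prod_dividef power_divide)
  moreover have "(2 * pi) powr (- real CARD('n) / 2) = (1 / sqrt (2 * pi)) ^ CARD('n)"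
    by (rule powr_minus_half_power) simp
  moreover have "- (\<Sum>i\<in>UNIV. (z $ i)\<^sup>2) / 2 = (\<Sum>i\<in>UNIV. - (z $ i)\<^sup>2 / 2)"
    by (simp add: sum_negf sum_divide_distrib)
  ultimately show ?thesis by simp
qed

lemma nn_integral_gauss_density:
  fixes A :: "real^'n^'n"
  assumes A: "det A \<noteq> 0" and S: "S = A ** transpose A" and [measurable]: "g \<in> borel_measurable borel"
  shows "(\<integral>\<^sup>+y. ennreal (gauss_density S y) * g y \<partial>lborel)
    = (\<integral>\<^sup>+z. (\<Prod>i\<in>UNIV. ennreal (std_normal_density (z $ i))) * g (A *v z) \<partial>lborel)"
proof -
  have "(\<integral>\<^sup>+y. ennreal (gauss_density S y) * g y \<partial>lborel)
     = (\<integral>\<^sup>+z. ennreal \<bar>det A\<bar> * (ennreal (gauss_density S (A *v z)) * g (A *v z)) \<partial>lborel)"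
    by (subst nn_integral_lborel_linear[OF A]) (simp_all add: nn_integral_cmult)
  also have "\<dots> = (\<integral>\<^sup>+z. ennreal (\<bar>det A\<bar> * gauss_density S (A *v z)) * g (A *v z) \<partial>lborel)"
    by (simp add: ennreal_mult mult.assoc)
  finally show ?thesis
    by (simp add: gauss_density_linear[OF A S] prod_ennreal)
qed

lemma nn_integral_std_normal_density: "(\<integral>\<^sup>+x. ennreal (std_normal_density x) \<partial>lborel) = 1"
  using prob_space.emeasure_space_1[OF prob_space_normal_density[of 1 0]] by (simp add: emeasure_density)

lemma nn_integral_gauss_density_shift:
  fixes S :: "real^'n^'n"
  assumes "pos_def_mat S"
  shows "(\<integral>\<^sup>+y. ennreal (gauss_density S (y - m)) \<partial>lborel) = 1"
proof -
  obtain A where A: "det A \<noteq> 0" "S = A ** transpose A"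
    using pos_def_mat_factor[OF assms] .
  have "(\<integral>\<^sup>+y. ennreal (gauss_density S (y - m)) \<partial>lborel)
      = (\<integral>\<^sup>+y. ennreal (gauss_density S y) \<partial>distr lborel borel ((+) (- m)))"
    by (subst nn_integral_distr) simp_all
  also have "\<dots> = (\<integral>\<^sup>+y. ennreal (gauss_density S y) \<partial>lborel)"
    by (simp only: lborel_distr_plus)
  also have "\<dots> = 1"
    using nn_integral_gauss_density[OF A, of "\<lambda>_. 1"]
      nn_integral_lborel_cart_prod[of "\<lambda>(_::'n) x. ennreal (std_normal_density x)"]
    by (simp add: nn_integral_std_normal_density)
  finally show ?thesis .
qed

text \<open>Take for w any row of the inverse of A. Then <w, A z> is a single coordinate of z, so
  the half space restricts one standard normal factor and the others integrate to 1.\<close>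

lemma gauss_density_marginal:
  fixes S :: "real^'n^'n"
  assumes "pos_def_mat S"
  obtains w where "(S *v w) \<bullet> w = 1"
    "\<And>s. emeasure (density lborel (\<lambda>y. ennreal (gauss_density S y))) {y. s < w \<bullet> y}
       = (\<integral>\<^sup>+x. ennreal (std_normal_density x) * indicator {s<..} x \<partial>lborel)"
proof -
  obtain A where A: "det A \<noteq> 0" "S = A ** transpose A"
    using pos_def_mat_factor[OF assms] .
  have "invertible A" using A(1) by (simp add: invertible_det_nz)
  then obtain W where W: "A ** W = mat 1" "W ** A = mat 1" by (auto simp: invertible_def)
  fix k :: 'n
  define w where "w = W $ k"
  have wA: "w \<bullet> (A *v z) = z $ k" for z
  proof -
    have "w \<bullet> (A *v z) = (W *v (A *v z)) $ k"
      by (simp add: w_def matrix_vector_mult_def inner_vec_def)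
    then show ?thesis by (simp add: matrix_vector_mul_assoc W)
  qed
  have "(S *v w) \<bullet> w = (transpose A *v w) $ k"
    using wA[of "transpose A *v w"] by (simp only: A(2) matrix_vector_mul_assoc inner_commute)
  also have "\<dots> = (transpose (W ** A)) $ k $ k"
    by (simp add: w_def matrix_vector_mult_def transpose_def matrix_matrix_mult_def mult.commute)
  finally have "(S *v w) \<bullet> w = 1" by (simp add: W transpose_mat) (simp add: mat_def)
  moreover have "emeasure (density lborel (\<lambda>y. ennreal (gauss_density S y))) {y. s < w \<bullet> y}
       = (\<integral>\<^sup>+x. ennreal (std_normal_density x) * indicator {s<..} x \<partial>lborel)" for s
  proof -
    let ?h = "\<lambda>i x. ennreal (std_normal_density x) * (if i = k then indicator {s<..} x else 1)"
    have "emeasure (density lborel (\<lambda>y. ennreal (gauss_density S y))) {y. s < w \<bullet> y}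
        = (\<integral>\<^sup>+y. ennreal (gauss_density S y) * indicator {y. s < w \<bullet> y} y \<partial>lborel)"
      by (subst emeasure_density) auto
    also have "\<dots> = (\<integral>\<^sup>+z. (\<Prod>i\<in>UNIV. ennreal (std_normal_density (z $ i)))
        * indicator {y. s < w \<bullet> y} (A *v z) \<partial>lborel)"
      by (intro nn_integral_gauss_density A) auto
    also have "\<dots> = (\<integral>\<^sup>+z. (\<Prod>i\<in>UNIV. ?h i (z $ i)) \<partial>lborel)"
      by (simp add: prod.distrib wA indicator_def)
    also have "\<dots> = (\<Prod>i\<in>UNIV. \<integral>\<^sup>+x. ?h i x \<partial>lborel)"
      by (intro nn_integral_lborel_cart_prod) auto
    also have "\<dots> = (\<Prod>i\<in>UNIV. if i = k then \<integral>\<^sup>+x. ennreal (std_normal_density x) * indicator {s<..} x \<partial>lborel else 1)"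
      by (intro prod.cong) (auto simp: nn_integral_std_normal_density)
    finally show ?thesis by simp
  qed
  ultimately show ?thesis using that by blast
qed

section \<open>The Mehler kernel acting on exponentials\<close>

lemma std_normal_tail_bounds:
  fixes s :: real
  assumes s: "1 \<le> s"
  defines "T \<equiv> \<integral>\<^sup>+x. ennreal (std_normal_density x) * indicator {s<..} x \<partial>lborel"
  shows "T \<le> ennreal (std_normal_density s / s)"
    and "ennreal (exp (- 2) * std_normal_density s / s) \<le> T"
proof -
  \<comment> \<open>Beyond s the factor x/s is at least 1, and x times the density has minus the
    density as primitive.\<close>
  have "T \<le> (\<integral>\<^sup>+x. ennreal (1 / s) * (ennreal (x * std_normal_density x) * indicator {s..} x) \<partial>lborel)"
    unfolding T_def
  proof (intro nn_integral_mono)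
    fix x
    show "ennreal (std_normal_density x) * indicator {s<..} x
        \<le> ennreal (1 / s) * (ennreal (x * std_normal_density x) * indicator {s..} x)"
    proof (cases "s < x")
      case True
      then have "1 * std_normal_density x \<le> (x / s) * std_normal_density x"
        using s by (intro mult_right_mono) auto
      then show ?thesis
        using True s by (simp add: ennreal_mult[symmetric] ennreal_leI)
    qed simp
  qed
  also have "\<dots> = ennreal (1 / s) * (\<integral>\<^sup>+x. ennreal (x * std_normal_density x) * indicator {s..} x \<partial>lborel)"
    by (rule nn_integral_cmult) simp
  also have "(\<integral>\<^sup>+x. ennreal (x * std_normal_density x) * indicator {s..} x \<partial>lborel) = ennreal (0 - - std_normal_density s)"
  proof (rule nn_integral_FTC_atLeast)
    show "((\<lambda>x. - std_normal_density x) has_real_derivative x * std_normal_density x) (at x)" for x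
    proof -
      have "((\<lambda>x. - (k * exp (- x\<^sup>2 / 2))) has_real_derivative x * (k * exp (- x\<^sup>2 / 2))) (at x)" for k
        by (auto intro!: derivative_eq_intros)
      then show ?thesis unfolding std_normal_density_def .
    qed
    show "((\<lambda>x. - std_normal_density x) \<longlongrightarrow> 0) at_top"
      unfolding std_normal_density_def by real_asymp
  qed (use s in auto)
  finally show "T \<le> ennreal (std_normal_density s / s)"
    using s by (simp add: ennreal_mult[symmetric])
next
  \<comment> \<open>On an interval of length 1/s the exponent s^2/2 grows by 1 + 1/(2 s^2), hence by
    less than 2 for s at least 1; this is the origin of exp(-2).\<close>
  let ?u = "s + 1 / s"
  have anti: "std_normal_density ?u \<le> std_normal_density x" if "s < x" "x \<le> ?u" for x
    using that s power_mono[of x ?u 2] by (simp add: std_normal_density_def divide_right_mono)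
  have "?u\<^sup>2 = s\<^sup>2 + 2 + 1 / s\<^sup>2" using s by (simp add: power2_sum power_divide)
  moreover have "1 / s\<^sup>2 \<le> 1" using s by (simp add: divide_le_eq_1)
  ultimately have "- 2 + - s\<^sup>2 / 2 \<le> - ?u\<^sup>2 / 2" by linarith
  then have "exp (- 2) * std_normal_density s \<le> std_normal_density ?u"
    by (simp add: std_normal_density_def exp_add[symmetric] divide_right_mono)
  then have "exp (- 2) * std_normal_density s / s \<le> std_normal_density ?u * (1 / s)"
    using s by (simp add: divide_right_mono)
  then have "ennreal (exp (- 2) * std_normal_density s / s) \<le> ennreal (std_normal_density ?u * (1 / s))"
    by (rule ennreal_leI)
  also have "\<dots> = (\<integral>\<^sup>+x. ennreal (std_normal_density ?u) * indicator {s<..?u} x \<partial>lborel)"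
    using s by (subst nn_integral_cmult_indicator) (auto simp: ennreal_mult[symmetric])
  also have "\<dots> \<le> T"
    unfolding T_def using anti by (intro nn_integral_mono) (auto simp: indicator_def intro: ennreal_leI)
  finally show "ennreal (exp (- 2) * std_normal_density s / s) \<le> T" .
qed

section \<open>Exponential tilting of Gaussians and the Mehler kernel as a transition
  density\<close>

lemma matrix_inv_pos_def:
  assumes "pos_def_mat S"
  shows "S ** matrix_inv S = mat 1" "matrix_inv S ** S = mat 1"
    "transpose (matrix_inv S) = matrix_inv S"
proof -
  have "invertible S"
    using pos_def_mat_det_pos[OF assms] by (simp add: invertible_det_nz)
  then obtain W where W: "S ** W = mat 1" "W ** S = mat 1" by (auto simp: invertible_def)
  have inv: "matrix_inv S = W" by (rule matrix_inv_unique[OF W(1)])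
  show "S ** matrix_inv S = mat 1" "matrix_inv S ** S = mat 1" by (simp_all add: inv W)
  have "S ** transpose W = transpose (W ** S)"
    using assms by (simp add: matrix_transpose_mul pos_def_mat_def)
  then have "S ** transpose W = mat 1" by (simp add: W transpose_mat)
  from matrix_inv_unique[OF this] show "transpose (matrix_inv S) = matrix_inv S" by (simp add: inv)
qed

lemma integral_gauss_density_shift:
  assumes "pos_def_mat S"
  shows "integrable lborel (\<lambda>y. gauss_density S (y - m))"
    and "(LINT y|lborel. gauss_density S (y - m)) = 1"
proof -
  have "has_bochner_integral lborel (\<lambda>y. gauss_density S (y - m)) 1"
    using nn_integral_gauss_density_shift[OF assms, of m]
    by (intro has_bochner_integral_nn_integral) auto
  then show "integrable lborel (\<lambda>y. gauss_density S (y - m))"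
    "(LINT y|lborel. gauss_density S (y - m)) = 1"
    by (auto simp: has_bochner_integral_iff)
qed

text \<open>Completing the square: an exponential weight moves the mean by S a and leaves the
  covariance. It is used with \<open>Qinf\<close> for the norm and with \<open>Qt t\<close> for the
  action of the semigroup.\<close>

lemma gauss_density_tilt:
  assumes "pos_def_mat S"
  shows "gauss_density S v * exp (a \<bullet> v) = exp ((S *v a) \<bullet> a / 2) * gauss_density S (v - S *v a)"
proof -
  let ?P = "matrix_inv S"
  have P: "?P *v (S *v a) = a"
    by (simp add: matrix_vector_mul_assoc matrix_inv_pos_def[OF assms])
  have "(?P *v (v - S *v a)) \<bullet> (v - S *v a) = (?P *v v) \<bullet> v - (?P *v v) \<bullet> (S *v a) - a \<bullet> v + a \<bullet> (S *v a)"
    by (simp add: matrix_vector_mult_diff_distrib inner_diff_left inner_diff_right P)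
  also have "(?P *v v) \<bullet> (S *v a) = v \<bullet> (transpose ?P *v (S *v a))"
    by (rule inner_matrix_transpose)
  also have "\<dots> = a \<bullet> v"
    by (simp add: matrix_inv_pos_def[OF assms] P inner_commute)
  finally have "(?P *v (v - S *v a)) \<bullet> (v - S *v a) = (?P *v v) \<bullet> v - 2 * (a \<bullet> v) + (S *v a) \<bullet> a"
    by (simp add: inner_commute)
  then show ?thesis
    by (simp add: gauss_density_def mult_exp_exp field_simps)
qed

lemma gauss_measure_eq:
  "gauss_measure Q B t = density lborel (\<lambda>y. ennreal (gauss_density (cov_mat Q B t) y))"
  by (simp add: gauss_measure_def gauss_density_def)

interpretation matrix_mult: bounded_bilinear "(**) :: real^'n^'n \<Rightarrow> real^'n^'n \<Rightarrow> real^'n^'n"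
  by (rule bounded_bilinear_matrix_mult)

context stable_pair
begin

lemma D_mat_eq: "D_mat Q B t = Qinf ** transpose (E (- t)) ** matrix_inv Qinf"
  by (simp only: D_mat_def E_def mat_exp_transpose)

text \<open>Both identities eliminate D_t from the exponent of the Mehler kernel: the first settles
  its linear term in u, the second its constant term.\<close>

lemma D_mat_identities:
  assumes "0 < t"
  defines "P \<equiv> matrix_inv Qinf" and "R \<equiv> matrix_inv (Qt t)" and "D \<equiv> D_mat Q B t"
  shows "(R - P) ** D = R ** E t"
    and "transpose D ** (R ** E t) = P + transpose (E t) ** R ** E t"
proof -
  note P = matrix_inv_pos_def[OF pos_def_Qinf, folded P_def]
  note R = matrix_inv_pos_def[OF pos_def_Qt[OF assms(1)], folded R_def]
  have ET: "transpose (E t) ** transpose (E (- t)) = mat 1"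
    by (simp add: matrix_transpose_mul[symmetric] E_uminus transpose_mat)
  have decomp: "Qinf - Qt t = E t ** Qinf ** transpose (E t)"
    using Qinf_decomp[of t] assms(1) by (simp add: algebra_simps)
  \<comment> \<open>Both R Q_t and P Q_\<infinity> are the identity, so the difference of inverses
    becomes the difference of covariances, which the splitting evaluates.\<close>
  have "(R - P) ** Qinf = R ** (Qinf - Qt t)"
    by (simp add: matrix_mult.diff_left matrix_mult.diff_right P R)
  also have "\<dots> = R ** E t ** Qinf ** transpose (E t)"
    by (simp add: decomp matrix_mul_assoc)
  finally have 1: "(R - P) ** Qinf = R ** E t ** Qinf ** transpose (E t)" .
  have "(R - P) ** D = (R - P) ** Qinf ** transpose (E (- t)) ** P"
    by (simp add: D_def D_mat_eq P_def matrix_mul_assoc)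
  also have "\<dots> = R ** E t ** Qinf ** (transpose (E t) ** transpose (E (- t))) ** P"
    unfolding 1 by (simp only: matrix_mul_assoc)
  also have "\<dots> = R ** E t ** (Qinf ** P)"
    unfolding ET matrix_mul_rid by (simp only: matrix_mul_assoc)
  finally show "(R - P) ** D = R ** E t" by (simp add: P)
  have "transpose Qinf = Qinf" using pos_def_Qinf by (simp add: pos_def_mat_def)
  then have "transpose D = P ** E (- t) ** Qinf"
    by (simp add: D_def D_mat_eq matrix_transpose_mul P P_def[symmetric] matrix_mul_assoc)
  \<comment> \<open>Splitting the middle Q_\<infinity> yields P from the summand Q_t, by Q_t R = 1,
    and the other term from the rest, by P Q_\<infinity> = 1.\<close>
  then have "transpose D ** (R ** E t) = P ** E (- t) ** (Qt t + E t ** Qinf ** transpose (E t)) ** (R ** E t)"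
    using Qinf_decomp[of t] assms(1) by simp
  also have "\<dots> = P ** (E (- t) ** ((Qt t ** R) ** E t))
      + P ** ((E (- t) ** E t) ** (Qinf ** (transpose (E t) ** (R ** E t))))"
    by (simp only: matrix_mult.add_left matrix_mult.add_right matrix_mul_assoc)
  also have "\<dots> = P + (P ** Qinf) ** (transpose (E t) ** (R ** E t))"
    by (simp only: R E_uminus matrix_mul_lid matrix_mul_rid matrix_mul_assoc)
  finally show "transpose D ** (R ** E t) = P + transpose (E t) ** R ** E t"
    by (simp add: P matrix_mul_assoc)
qed

text \<open>This reconciles the kernel form with Kolmogorov's formula: relative to Lebesgue measure
  the kernel is the Gaussian density with mean exp(tB) x and covariance Q_t. The exponents are
  compared as quadratic polynomials in u.\<close>

lemma mehler_kernel_density: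
  assumes t: "0 < t"
  shows "gauss_density Qinf u * mehler_kernel Q B t x u = gauss_density (Qt t) (u - E t *v x)"
proof -
  define P R D where "P = matrix_inv Qinf" and "R = matrix_inv (Qt t)" and "D = D_mat Q B t"
  note P = matrix_inv_pos_def[OF pos_def_Qinf, folded P_def]
  note R = matrix_inv_pos_def[OF pos_def_Qt[OF t], folded R_def]
  note D = D_mat_identities[OF t, folded P_def R_def D_def]
  let ?M = "R - P" and ?e = "E t *v x"
  have sym: "(X *v y) \<bullet> z = (X *v z) \<bullet> y" if "transpose X = X" for X :: "real^'n^'n" and y z
    using inner_matrix_transpose[of X y z] that by (simp add: inner_commute)
  have M: "transpose ?M = ?M" using P R by (simp add: transpose_def vec_eq_iff)
  have MD: "?M *v (D *v x) = R *v ?e"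
    by (simp add: matrix_vector_mul_assoc D(1))
  have "(R *v ?e) \<bullet> (D *v x) = x \<bullet> (transpose D *v (R *v ?e))"
    using inner_matrix_transpose[of D x "R *v ?e"] by (simp only: inner_commute)
  also have "\<dots> = x \<bullet> ((P + transpose (E t) ** R ** E t) *v x)"
    by (simp only: matrix_vector_mul_assoc D(2))
  also have "\<dots> = x \<bullet> (P *v x) + x \<bullet> (transpose (E t) *v (R *v ?e))"
    by (simp only: matrix_vector_mult_add_rdistrib inner_add_right matrix_vector_mul_assoc matrix_mul_assoc)
  also have "x \<bullet> (transpose (E t) *v (R *v ?e)) = ?e \<bullet> (R *v ?e)"
    by (simp only: inner_matrix_transpose)
  \<comment> \<open>The constant term; its part <P x, x> is what \<open>R_form\<close>
    cancels.\<close>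
  finally have RD: "(R *v ?e) \<bullet> (D *v x) = (P *v x) \<bullet> x + (R *v ?e) \<bullet> ?e"
    by (simp add: inner_commute)
  have "(?M *v (u - D *v x)) \<bullet> (u - D *v x)
      = (?M *v u) \<bullet> u - (?M *v u) \<bullet> (D *v x) - (R *v ?e) \<bullet> u + (R *v ?e) \<bullet> (D *v x)"
    by (simp add: matrix_vector_mult_diff_distrib MD inner_diff_left inner_diff_right)
  also have "(?M *v u) \<bullet> (D *v x) = (R *v ?e) \<bullet> u"
    by (simp add: sym[OF M, of u] MD)
  finally have 1: "(?M *v (u - D *v x)) \<bullet> (u - D *v x)
      = (R *v u) \<bullet> u - (P *v u) \<bullet> u - 2 * ((R *v ?e) \<bullet> u) + (P *v x) \<bullet> x + (R *v ?e) \<bullet> ?e"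
    by (simp add: RD matrix_vector_mult_diff_rdistrib inner_diff_left)
  have 2: "(R *v (u - ?e)) \<bullet> (u - ?e) = (R *v u) \<bullet> u - 2 * ((R *v ?e) \<bullet> u) + (R *v ?e) \<bullet> ?e"
    using sym[OF R(3), of u ?e] by (simp add: matrix_vector_mult_diff_distrib inner_diff_left inner_diff_right)
  have "- (1 / 2) * ((P *v u) \<bullet> u) + (R_form Q B x + - (1 / 2) * ((?M *v (u - D *v x)) \<bullet> (u - D *v x)))
      = - (1 / 2) * ((R *v (u - ?e)) \<bullet> (u - ?e))"
    unfolding 1 2 R_form_def P_def[symmetric] by (simp add: field_simps)
  then have exps: "exp (- (1 / 2) * ((P *v u) \<bullet> u)) * (exp (R_form Q B x) * exp (- (1 / 2) * ((?M *v (u - D *v x)) \<bullet> (u - D *v x))))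
      = exp (- (1 / 2) * ((R *v (u - ?e)) \<bullet> (u - ?e)))"
    by (simp only: exp_add[symmetric])
  have dets: "det Qinf powr (- 1 / 2) * (det Qinf / det (Qt t)) powr (1 / 2) = det (Qt t) powr (- 1 / 2)"
    using pos_def_mat_det_pos[OF pos_def_Qinf] pos_def_mat_det_pos[OF pos_def_Qt[OF t]]
    by (simp add: powr_divide powr_minus_divide)
  have "gauss_density Qinf u * mehler_kernel Q B t x u
     = (2 * pi) powr (- real CARD('n) / 2) * (det Qinf powr (- 1 / 2) * (det Qinf / det (Qt t)) powr (1 / 2))
       * (exp (- (1 / 2) * ((P *v u) \<bullet> u)) * (exp (R_form Q B x) * exp (- (1 / 2) * ((?M *v (u - D *v x)) \<bullet> (u - D *v x)))))"
    unfolding gauss_density_def mehler_kernel_def P_def[symmetric] R_def[symmetric] D_def[symmetric]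
    by (simp only: mult.assoc mult.left_commute)
  then show ?thesis
    unfolding dets exps gauss_density_def R_def[symmetric] .
qed

text \<open>Tilting turns f times the density of \<gamma>_\<infinity> into the Gaussian density with
  mean Q_\<infinity> a, so the norm is 1 for every a.\<close>

lemma exponential_normalized:
  defines "f \<equiv> \<lambda>a u. exp (a \<bullet> u - (Qinf *v a) \<bullet> a / 2)"
  shows "integrable (gauss_measure Q B \<infinity>) (f a)"
    and "(LINT u|gauss_measure Q B \<infinity>. \<bar>f a u\<bar>) = 1"
proof -
  have fm: "f a \<in> borel_measurable lborel" unfolding f_def by measurable
  have f: "gauss_density Qinf u * f a u = gauss_density Qinf (u - Qinf *v a)" for u
    using gauss_density_tilt[OF pos_def_Qinf, of u a]
    by (simp add: f_def exp_diff)
  show "integrable (gauss_measure Q B \<infinity>) (f a)"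
    unfolding gauss_measure_eq
    by (subst integrable_real_density[OF _ _ fm])
      (simp_all add: f integral_gauss_density_shift[OF pos_def_Qinf])
  have "(LINT u|gauss_measure Q B \<infinity>. \<bar>f a u\<bar>) = (LINT u|gauss_measure Q B \<infinity>. f a u)"
    by (simp add: f_def)
  also have "\<dots> = (LINT u|lborel. gauss_density Qinf u * f a u)"
    unfolding gauss_measure_eq by (rule integral_real_density) (use fm in auto)
  finally show "(LINT u|gauss_measure Q B \<infinity>. \<bar>f a u\<bar>) = 1"
    by (simp add: f integral_gauss_density_shift[OF pos_def_Qinf])
qed

text \<open>Tilting the transition density by a leaves the factor exp(<Q_t a, a>/2). By the
  splitting, <Q_t a, a> - <Q_\<infinity> a, a> = -<Q_\<infinity> b, b>, so the normalization
  reproduces itself.\<close>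

lemma OU_semigroup_exponential:
  fixes a x :: "real^'n"
  assumes t: "0 < t"
  defines "b \<equiv> transpose (E t) *v a"
  shows "OU_semigroup Q B t (\<lambda>u. exp (a \<bullet> u - (Qinf *v a) \<bullet> a / 2)) x
    = exp (b \<bullet> x - (Qinf *v b) \<bullet> b / 2)"
proof -
  let ?f = "\<lambda>u. exp (a \<bullet> u - (Qinf *v a) \<bullet> a / 2)" and ?e = "E t *v x"
  have "(Qinf *v a) \<bullet> a = (Qt t *v a) \<bullet> a + ((E t ** Qinf ** transpose (E t)) *v a) \<bullet> a"
    by (subst Qinf_decomp[of t]) (use t in \<open>simp_all only: matrix_vector_mult_add_rdistrib inner_add_left\<close>)
  also have "((E t ** Qinf ** transpose (E t)) *v a) \<bullet> a = (Qinf *v b) \<bullet> b"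
    unfolding matrix_vector_mul_assoc[symmetric] inner_matrix_transpose[of "E t"] b_def ..
  finally have q: "(Qinf *v a) \<bullet> a = (Qt t *v a) \<bullet> a + (Qinf *v b) \<bullet> b" .
  have ab: "a \<bullet> ?e = b \<bullet> x"
    using inner_matrix_transpose[of "E t" x a] by (simp add: b_def inner_commute)
  have meas: "(\<lambda>u. mehler_kernel Q B t x u * ?f u) \<in> borel_measurable lborel"
    unfolding mehler_kernel_def by measurable
  have "gauss_density Qinf u * (mehler_kernel Q B t x u * ?f u)
      = exp (b \<bullet> x - (Qinf *v b) \<bullet> b / 2) * gauss_density (Qt t) (u - (?e + Qt t *v a))" for u
  proof -
    have "gauss_density Qinf u * (mehler_kernel Q B t x u * ?f u) = gauss_density (Qt t) (u - ?e) * ?f u"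
      by (simp only: mult.assoc[symmetric] mehler_kernel_density[OF t])
    also have "\<dots> = gauss_density (Qt t) (u - ?e) * (exp (a \<bullet> (u - ?e)) * exp (b \<bullet> x - (Qinf *v a) \<bullet> a / 2))"
      by (simp add: mult_exp_exp inner_diff_right ab)
    also have "\<dots> = exp ((Qt t *v a) \<bullet> a / 2) * gauss_density (Qt t) (u - ?e - Qt t *v a) * exp (b \<bullet> x - (Qinf *v a) \<bullet> a / 2)"
      by (simp only: mult.assoc[symmetric] gauss_density_tilt[OF pos_def_Qt[OF t]])
    also have "\<dots> = (exp ((Qt t *v a) \<bullet> a / 2) * exp (b \<bullet> x - (Qinf *v a) \<bullet> a / 2))
        * gauss_density (Qt t) (u - ?e - Qt t *v a)"
      by (simp only: mult_ac)
    also have "exp ((Qt t *v a) \<bullet> a / 2) * exp (b \<bullet> x - (Qinf *v a) \<bullet> a / 2) = exp (b \<bullet> x - (Qinf *v b) \<bullet> b / 2)"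
      by (simp add: mult_exp_exp q add_divide_distrib)
    finally show ?thesis by (simp add: algebra_simps)
  qed
  then have "OU_semigroup Q B t ?f x
      = (LINT u|lborel. exp (b \<bullet> x - (Qinf *v b) \<bullet> b / 2) * gauss_density (Qt t) (u - (?e + Qt t *v a)))"
    unfolding OU_semigroup_def gauss_measure_eq
    by (subst integral_real_density[OF _ _ meas]) simp_all
  then show ?thesis
    by (simp add: integral_gauss_density_shift[OF pos_def_Qt[OF t]])
qed

text \<open>At s = sqrt(2 ln \<alpha>) the normal density is 1/(sqrt(2 pi) \<alpha>), and division
  by s = sqrt 2 sqrt(ln \<alpha>) gives the constant K.\<close>

lemma exponential_level_set_bounds:
  defines "K \<equiv> 1 / (sqrt (2 * pi) * sqrt 2)"
  assumes t: "0 < t" and \<alpha>: "exp 1 < \<alpha>"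
  shows "\<exists>f. integrable (gauss_measure Q B \<infinity>) f \<and> (LINT u|gauss_measure Q B \<infinity>. \<bar>f u\<bar>) = 1 \<and>
     exp (- 2) * K / (\<alpha> * sqrt (ln \<alpha>))
       \<le> measure (gauss_measure Q B \<infinity>) {x. \<bar>OU_semigroup Q B t f x\<bar> > \<alpha>} \<and>
     measure (gauss_measure Q B \<infinity>) {x. \<bar>OU_semigroup Q B t f x\<bar> > \<alpha>} \<le> K / (\<alpha> * sqrt (ln \<alpha>))"
proof -
  obtain w where w: "(Qinf *v w) \<bullet> w = 1"
    and marginal: "\<And>s. emeasure (gauss_measure Q B \<infinity>) {y. s < w \<bullet> y}
       = (\<integral>\<^sup>+x. ennreal (std_normal_density x) * indicator {s<..} x \<partial>lborel)"
    using gauss_density_marginal[OF pos_def_Qinf] unfolding gauss_measure_eq by blast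
  define s where "s = sqrt (2 * ln \<alpha>)"
  have "1 \<le> exp (1 :: real)" by simp
  with \<alpha> have \<alpha>1: "1 \<le> \<alpha>" by linarith
  then have \<alpha>0: "0 < \<alpha>" by simp
  have ln: "1 < ln \<alpha>" using \<alpha> \<alpha>0 by (metis ln_exp ln_less_cancel_iff exp_gt_zero)
  have s2: "s\<^sup>2 = 2 * ln \<alpha>" using ln by (simp add: s_def)
  \<comment> \<open>The threshold exp 1 for \<alpha> serves to put s in the range of the tail
    bounds.\<close>
  have s: "1 \<le> s" using ln by (simp add: s_def)
  define b where "b = s *\<^sub>R w"
  \<comment> \<open>Pulls b back through the transposed flow: a, and with it f, depends on t, but b
    and the level set do not.\<close>
  define a where "a = transpose (E (- t)) *v b"
  define f where "f u = exp (a \<bullet> u - (Qinf *v a) \<bullet> a / 2)" for u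
  have b: "transpose (E t) *v a = b"
    by (simp only: a_def matrix_vector_mul_assoc matrix_transpose_mul[symmetric] E_uminus transpose_mat
        matrix_vector_mul_lid)
  have "(Qinf *v b) \<bullet> b = s\<^sup>2"
    by (simp add: b_def matrix_vector_mult_scaleR w power2_eq_square)
  then have H: "OU_semigroup Q B t f x = exp (s * (w \<bullet> x) - ln \<alpha>)" for x
    using OU_semigroup_exponential[OF t, of a x] unfolding b f_def[symmetric]
    by (simp add: s2 b_def)
  have "\<bar>OU_semigroup Q B t f x\<bar> > \<alpha> \<longleftrightarrow> s < w \<bullet> x" for x
  proof -
    have "\<bar>OU_semigroup Q B t f x\<bar> > \<alpha> \<longleftrightarrow> exp (ln \<alpha>) < exp (s * (w \<bullet> x) - ln \<alpha>)"
      using \<alpha>0 by (simp add: H)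
    also have "\<dots> \<longleftrightarrow> s * s < s * (w \<bullet> x)"
      using s2 by (simp only: exp_less_cancel_iff power2_eq_square) linarith
    also have "\<dots> \<longleftrightarrow> s < w \<bullet> x" using s by simp
    finally show ?thesis .
  qed
  then have level: "{x. \<bar>OU_semigroup Q B t f x\<bar> > \<alpha>} = {x. s < w \<bullet> x}" by simp
  have "exp (- s\<^sup>2 / 2) = 1 / \<alpha>"
    using \<alpha>0 by (simp add: s2 exp_minus inverse_eq_divide)
  then have dens: "std_normal_density s / s = K / (\<alpha> * sqrt (ln \<alpha>))"
    unfolding std_normal_density_def by (simp add: K_def s_def real_sqrt_mult)
  let ?m = "emeasure (gauss_measure Q B \<infinity>) {x. s < w \<bullet> x}"
  have up: "?m \<le> ennreal (K / (\<alpha> * sqrt (ln \<alpha>)))"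
    and low: "ennreal (exp (- 2) * K / (\<alpha> * sqrt (ln \<alpha>))) \<le> ?m"
    using std_normal_tail_bounds[OF s] unfolding marginal[symmetric] dens times_divide_eq_right[symmetric] by auto
  have nn: "0 \<le> K / (\<alpha> * sqrt (ln \<alpha>))" using \<alpha>1 unfolding K_def
    by (intro divide_nonneg_nonneg mult_nonneg_nonneg) auto
  have "measure (gauss_measure Q B \<infinity>) {x. s < w \<bullet> x} \<le> K / (\<alpha> * sqrt (ln \<alpha>))"
    unfolding measure_def using up nn by (simp add: enn2real_leI)
  moreover have "exp (- 2) * K / (\<alpha> * sqrt (ln \<alpha>)) \<le> measure (gauss_measure Q B \<infinity>) {x. s < w \<bullet> x}"
  proof -
    \<comment> \<open>Finiteness excludes the default value 0 that \<open>enn2real\<close> takes at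
      infinity, which would spoil the lower bound.\<close>
    have "?m < \<infinity>" using up by (rule le_less_trans) simp
    then have "enn2real (ennreal (exp (- 2) * K / (\<alpha> * sqrt (ln \<alpha>)))) \<le> enn2real ?m"
      by (intro enn2real_mono low) simp
    moreover have "0 \<le> exp (- 2) * K / (\<alpha> * sqrt (ln \<alpha>))"
      using mult_nonneg_nonneg[OF exp_ge_zero[of "- 2"] nn] by (simp only: times_divide_eq_right)
    ultimately show ?thesis unfolding measure_def by (simp only: enn2real_ennreal)
  qed
  ultimately show ?thesis
    using exponential_normalized[of a] unfolding level[symmetric] f_def[symmetric] by blast
qed

end

theorem proposition6p2:
  fixes Q B :: "real^'n^'n"
  assumes "pos_def_mat Q"
    and "\<And>z. cpx_eigenvalue B z \<Longrightarrow> Re z < 0"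
  shows "\<exists>(\<alpha>\<^sub>0 :: real) (c :: real) (C :: real). 0 < c \<and> c \<le> C \<and>
    (\<forall>(t :: real) (\<alpha> :: real). t > 1 \<longrightarrow> \<alpha> > \<alpha>\<^sub>0 \<longrightarrow>
      (\<exists>f :: real^'n \<Rightarrow> real.
         integrable (gauss_measure Q B \<infinity>) f \<and>
         integral\<^sup>L (gauss_measure Q B \<infinity>) (\<lambda>u. \<bar>f u\<bar>) = 1 \<and>
         c / (\<alpha> * sqrt (ln \<alpha>))
           \<le> measure (gauss_measure Q B \<infinity>) {x. \<bar>OU_semigroup Q B t f x\<bar> > \<alpha>} \<and>
         measure (gauss_measure Q B \<infinity>) {x. \<bar>OU_semigroup Q B t f x\<bar> > \<alpha>}
           \<le> C / (\<alpha> * sqrt (ln \<alpha>))))"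
proof -
  interpret stable_pair Q B using assms by unfold_locales
  let ?K = "1 / (sqrt (2 * pi) * sqrt 2)"
  show ?thesis
  \<comment> \<open>The constants c and C differ only by the factor exp(-2) lost in the lower tail
    bound.\<close>
  proof (rule exI[of _ "exp 1"], rule exI[of _ "exp (- 2) * ?K"], rule exI[of _ ?K], intro conjI allI impI)
    show "0 < exp (- 2) * ?K" by simp
    have "exp (- 2 :: real) \<le> 1" by simp
    then show "exp (- 2) * ?K \<le> ?K" by (intro mult_left_le_one_le) auto
    fix t \<alpha> :: real
    assume "1 < t" "exp 1 < \<alpha>"
    then show "\<exists>f. integrable (gauss_measure Q B \<infinity>) f \<and>
        (LINT u|gauss_measure Q B \<infinity>. \<bar>f u\<bar>) = 1 \<and>
        exp (- 2) * ?K / (\<alpha> * sqrt (ln \<alpha>))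
          \<le> measure (gauss_measure Q B \<infinity>) {x. \<bar>OU_semigroup Q B t f x\<bar> > \<alpha>} \<and>
        measure (gauss_measure Q B \<infinity>) {x. \<bar>OU_semigroup Q B t f x\<bar> > \<alpha>}
          \<le> ?K / (\<alpha> * sqrt (ln \<alpha>))"
      by (intro exponential_level_set_bounds) auto
  qed
qed

end
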